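(* Consider the map $g:\mathbb{R}^{14}\to G_2$, $$g(a_1,\dots,a_{14})=\sigma(a_1,a_2,a_3)\,s(a_4,a_5,a_6)\,e^{\sqrt3\,a_7C_{11}}\,e^{a_8C_5}\,s(a_9,a_{10},a_{11})\,\sigma(a_{12},a_{13},a_{14}).$$ Let $\omega$ be the invariant volume form on $G_2$ associated with the bi-invariant metric for which $(X,Y)=-\tfrac14\mathrm{Tr}(XY)$ on $\mathrm{Lie}(G_2)$. Then, up to an overall sign depending only on the choice of orientation, the pullback of $\omega$ under $g$ is $$27\sqrt3\; f(2a_7,2a_8)\,\sin(2a_2)\,\sin(2a_5)\,\sin(2a_{10})\,\sin(2a_{13})\; da_1\wedge\dots\wedge da_{14},$$ where $$f(\alpha,\beta)=\sin\!\Big(\frac{\beta-\alpha}{2}\Big)\sin\!\Big(\frac{\beta+\alpha}{2}\Big)\sin\!\Big(\frac{\beta-3\alpha}{2}\Big)\sin\!\Big(\frac{\beta+3\alpha}{2}\Big)\sin(\alpha)\sin(\beta).$$ In other words, in the coordinates $a_1,\dots,a_{14}$ the Haar measure of $G_2$ (with this normalization) is $d\mu=27\sqrt3\,f(2a_7,2a_8)\sin(2a_2)\sin(2a_5)\sin(2a_{10})\sin(2a_{13})\prod_{i=1}^{14}da_i$ (up to sign).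
   Context: The octonions $\mathbb{O}$ are pairs of quaternions with product $(\alpha_1,\alpha_2)(\beta_1,\beta_2)=(\alpha_1\beta_1-\bar\beta_2\alpha_2,\ \beta_2\alpha_1+\alpha_2\bar\beta_1)$. The canonical basis is $e_0=(1,0)$, $e_1=(i,0)$, $e_2=(j,0)$, $e_3=(k,0)$, $e_4=(0,1)$, $e_5=(0,i)$, $e_6=(0,j)$, $e_7=(0,k)$. $G_2$ is the group of algebra automorphisms of $\mathbb{O}$; it fixes $e_0$ and is identified with a group of $7\times7$ real matrices acting on column vectors of coordinates with respect to $e_1,\dots,e_7$. Let $E_{ij}$ be the $7\times 7$ matrix units and $A_{ij}=E_{ij}-E_{ji}$. The following are elements of $\mathrm{Lie}(G_2)$: $$C_2=A_{46}-A_{57},\qquad C_3=-A_{45}-A_{67},\qquad C_5=-A_{26}+A_{37},$$ $$C_8=\tfrac1{\sqrt3}(-2A_{23}+A_{45}-A_{67}),\qquad C_9=\tfrac1{\sqrt3}(-2A_{12}+A_{47}-A_{56}),\qquad C_{11}=\tfrac1{\sqrt3}(-2A_{14}-A_{27}+A_{36}).$$ Define $$s(x,y,z)=e^{xC_3}e^{yC_2}e^{zC_3},\qquad \sigma(x,y,z)=e^{\sqrt3\,xC_8}e^{\sqrt3\,yC_9}e^{\sqrt3\,zC_8}.$$ The inner product $(X,Y)=-\tfrac14\mathrm{Tr}(XY)$ (trace of $7\times7$ matrices) on $\mathrm{Lie}(G_2)$ equals $-\tfrac1{16}$ times the Killing form. If $C_1,\dots,C_{14}$ is an orthonormal basis of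 $\mathrm{Lie}(G_2)$ for it and the left-invariant forms $J^I$ are defined by $g^{-1}dg=\sum_I J^IC_I$, then $\omega=J^1\wedge\dots\wedge J^{14}$. *)

theory Defs
  imports "HOL-Analysis.Analysis"
begin

text \<open>A quaternion \<open>a + b i + c j + d k\<close> is the tuple \<open>(a, b, c, d)\<close>; the real vector space
  structure on quaternions and octonions is the library's componentwise one.\<close>

type_synonym quat = "real \<times> real \<times> real \<times> real"
type_synonym octonion = "quat \<times> quat"

fun qmul :: "quat \<Rightarrow> quat \<Rightarrow> quat" where
  "qmul (a1, b1, c1, d1) (a2, b2, c2, d2) =
     (a1 * a2 - b1 * b2 - c1 * c2 - d1 * d2,
      a1 * b2 + b1 * a2 + c1 * d2 - d1 * c2,
      a1 * c2 - b1 * d2 + c1 * a2 + d1 * b2,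
      a1 * d2 + b1 * c2 - c1 * b2 + d1 * a2)"

fun qcnj :: "quat \<Rightarrow> quat" where
  "qcnj (a, b, c, d) = (a, - b, - c, - d)"

fun omul :: "octonion \<Rightarrow> octonion \<Rightarrow> octonion" where
  "omul (\<alpha>1, \<alpha>2) (\<beta>1, \<beta>2) =
     (qmul \<alpha>1 \<beta>1 - qmul (qcnj \<beta>2) \<alpha>2, qmul \<beta>2 \<alpha>1 + qmul \<alpha>2 (qcnj \<beta>1))"

text \<open>In the finite index types the numerals count from 1: \<open>1, \<dots>, 7\<close> (resp. \<open>1, \<dots>, 14\<close>) are the
  distinct elements of the type \<open>7\<close> (resp. \<open>14\<close>), the last one being equal to \<open>0\<close>.\<close>

definition im_basis :: "7 \<Rightarrow> octonion" where
  "im_basis i =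
     (if i = 1 then ((0, 1, 0, 0), 0)
      else if i = 2 then ((0, 0, 1, 0), 0)
      else if i = 3 then ((0, 0, 0, 1), 0)
      else if i = 4 then (0, (1, 0, 0, 0))
      else if i = 5 then (0, (0, 1, 0, 0))
      else if i = 6 then (0, (0, 0, 1, 0))
      else (0, (0, 0, 0, 1)))"

definition octonion_automorphism :: "(octonion \<Rightarrow> octonion) \<Rightarrow> bool" where
  "octonion_automorphism f \<longleftrightarrow>
     linear f \<and> bij f \<and> (\<forall>x y. f (omul x y) = omul (f x) (f y))"

definition G2 :: "(real ^ 7 ^ 7) set" where
  "G2 = {M. \<exists>f. octonion_automorphism f \<and>
              (\<forall>j. f (im_basis j) = (\<Sum>i\<in>UNIV. (M $ i $ j) *\<^sub>R im_basis i))}"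

text \<open>The exponential series is written out because the library's multiplication on
  \<open>real ^ 7 ^ 7\<close> (hence its power and \<open>exp\<close>) is not the matrix product.\<close>

definition matpow :: "real ^ 'n ^ 'n \<Rightarrow> nat \<Rightarrow> real ^ 'n ^ 'n" where
  "matpow A k = (((**) A) ^^ k) (mat 1)"

definition mexp :: "real ^ 'n ^ 'n \<Rightarrow> real ^ 'n ^ 'n" where
  "mexp A = (\<Sum>k. (1 / fact k) *\<^sub>R matpow A k)"

definition lie_G2 :: "(real ^ 7 ^ 7) set" where
  "lie_G2 = {X. \<forall>t::real. mexp (t *\<^sub>R X) \<in> G2}"

definition E :: "7 \<Rightarrow> 7 \<Rightarrow> real ^ 7 ^ 7" where
  "E i j = (\<chi> r c. if r = i \<and> c = j then 1 else 0)"

definition A :: "7 \<Rightarrow> 7 \<Rightarrow> real ^ 7 ^ 7" where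
  "A i j = E i j - E j i"

definition C2 :: "real ^ 7 ^ 7" where "C2 = A 4 6 - A 5 7"
definition C3 :: "real ^ 7 ^ 7" where "C3 = - A 4 5 - A 6 7"
definition C5 :: "real ^ 7 ^ 7" where "C5 = - A 2 6 + A 3 7"
definition C8 :: "real ^ 7 ^ 7" where
  "C8 = (1 / sqrt 3) *\<^sub>R (- 2 *\<^sub>R A 2 3 + A 4 5 - A 6 7)"
definition C9 :: "real ^ 7 ^ 7" where
  "C9 = (1 / sqrt 3) *\<^sub>R (- 2 *\<^sub>R A 1 2 + A 4 7 - A 5 6)"
definition C11 :: "real ^ 7 ^ 7" where
  "C11 = (1 / sqrt 3) *\<^sub>R (- 2 *\<^sub>R A 1 4 - A 2 7 + A 3 6)"

definition s_map :: "real \<Rightarrow> real \<Rightarrow> real \<Rightarrow> real ^ 7 ^ 7" where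
  "s_map x y z = mexp (x *\<^sub>R C3) ** mexp (y *\<^sub>R C2) ** mexp (z *\<^sub>R C3)"

definition sigma_map :: "real \<Rightarrow> real \<Rightarrow> real \<Rightarrow> real ^ 7 ^ 7" where
  "sigma_map x y z =
     mexp ((sqrt 3 * x) *\<^sub>R C8) ** mexp ((sqrt 3 * y) *\<^sub>R C9) ** mexp ((sqrt 3 * z) *\<^sub>R C8)"

definition g_map :: "real ^ 14 \<Rightarrow> real ^ 7 ^ 7" where
  "g_map a =
     sigma_map (a $ 1) (a $ 2) (a $ 3) ** s_map (a $ 4) (a $ 5) (a $ 6) **
     mexp ((sqrt 3 * a $ 7) *\<^sub>R C11) ** mexp ((a $ 8) *\<^sub>R C5) **
     s_map (a $ 9) (a $ 10) (a $ 11) ** sigma_map (a $ 12) (a $ 13) (a $ 14)"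

definition f_fun :: "real \<Rightarrow> real \<Rightarrow> real" where
  "f_fun \<alpha> \<beta> =
     sin ((\<beta> - \<alpha>) / 2) * sin ((\<beta> + \<alpha>) / 2) *
     sin ((\<beta> - 3 * \<alpha>) / 2) * sin ((\<beta> + 3 * \<alpha>) / 2) * sin \<alpha> * sin \<beta>"

definition ip :: "real ^ 7 ^ 7 \<Rightarrow> real ^ 7 ^ 7 \<Rightarrow> real" where
  "ip X Y = - (1 / 4) * trace (X ** Y)"

definition orthonormal_basis_lie :: "(14 \<Rightarrow> real ^ 7 ^ 7) \<Rightarrow> bool" where
  "orthonormal_basis_lie C \<longleftrightarrow>
     (\<forall>I. C I \<in> lie_G2) \<and> span (range C) = lie_G2 \<and>
     (\<forall>I K. ip (C I) (C K) = (if I = K then 1 else 0))"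

definition same_orientation ::
  "(14 \<Rightarrow> real ^ 7 ^ 7) \<Rightarrow> (14 \<Rightarrow> real ^ 7 ^ 7) \<Rightarrow> bool" where
  "same_orientation C C' \<longleftrightarrow>
     det (\<chi> I K. representation (range C) (C' K) (C I) :: real ^ 14 ^ 14) > 0"

text \<open>The wedge product of \<open>CARD('n)\<close> one-forms, in the convention without a factor
  \<open>1 / CARD('n)!\<close>.\<close>

definition wedge :: "('n::finite \<Rightarrow> 'v \<Rightarrow> real) \<Rightarrow> ('n \<Rightarrow> 'v) \<Rightarrow> real" where
  "wedge \<theta> v = det (\<chi> i k. \<theta> i (v k) :: real ^ 'n ^ 'n)"

text \<open>\<open>left_form C I p v\<close> is the value of \<open>J\<^sup>I\<close> at \<open>p\<close> on the tangent vector \<open>v\<close>, i.e. the \<open>I\<close>-th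
  coefficient of \<open>p\<^sup>-\<^sup>1 v = (\<Sum>I. J\<^sup>I(v) C\<^sub>I)\<close>.\<close>

definition left_form ::
  "(14 \<Rightarrow> real ^ 7 ^ 7) \<Rightarrow> 14 \<Rightarrow> real ^ 7 ^ 7 \<Rightarrow> real ^ 7 ^ 7 \<Rightarrow> real" where
  "left_form C I p v = representation (range C) (matrix_inv p ** v) (C I)"

definition volume_form ::
  "(14 \<Rightarrow> real ^ 7 ^ 7) \<Rightarrow> real ^ 7 ^ 7 \<Rightarrow> (14 \<Rightarrow> real ^ 7 ^ 7) \<Rightarrow> real" where
  "volume_form C p = wedge (\<lambda>I. left_form C I p)"

definition pullback ::
  "('v::real_normed_vector \<Rightarrow> 'w::real_normed_vector) \<Rightarrow> ('w \<Rightarrow> ('n \<Rightarrow> 'w) \<Rightarrow> real) \<Rightarrow>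
   'v \<Rightarrow> ('n \<Rightarrow> 'v) \<Rightarrow> real" where
  "pullback \<phi> \<omega> a u = \<omega> (\<phi> a) (\<lambda>k. frechet_derivative \<phi> (at a) (u k))"

definition coordinates_on :: "(real ^ 14) set \<Rightarrow> (real ^ 14 \<Rightarrow> real ^ 7 ^ 7) \<Rightarrow> bool" where
  "coordinates_on U \<phi> \<longleftrightarrow>
     open U \<and> inj_on \<phi> U \<and> \<phi> ` U \<subseteq> G2 \<and>
     (\<forall>a\<in>U. \<phi> differentiable at a \<and> inj (frechet_derivative \<phi> (at a))) \<and>
     (\<forall>v. continuous_on U (\<lambda>a. frechet_derivative \<phi> (at a) v))"

definition haar_measure :: "(real ^ 7 ^ 7) measure \<Rightarrow> bool" where
  "haar_measure \<mu> \<longleftrightarrow>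
     sets \<mu> = sets (restrict_space borel G2) \<and>
     emeasure \<mu> G2 \<noteq> 0 \<and> emeasure \<mu> G2 \<noteq> \<infinity> \<and>
     (\<forall>h\<in>G2. \<forall>S\<in>sets \<mu>. emeasure \<mu> ((\<lambda>p. h ** p) ` S) = emeasure \<mu> S)"

text \<open>\<open>\<mu>\<close> is the measure \<open>\<bar>\<omega>\<bar>\<close> of a top-degree form \<open>\<omega>\<close> on the group, which is determined by its
  values in local coordinates.\<close>

definition normalized_by ::
  "(real ^ 7 ^ 7 \<Rightarrow> (14 \<Rightarrow> real ^ 7 ^ 7) \<Rightarrow> real) \<Rightarrow> (real ^ 7 ^ 7) measure \<Rightarrow> bool" where
  "normalized_by \<omega> \<mu> \<longleftrightarrow>
     (\<forall>U \<phi>. coordinates_on U \<phi> \<longrightarrow>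
        (\<forall>B\<in>sets borel. B \<subseteq> U \<longrightarrow>
           emeasure \<mu> (\<phi> ` B) =
             (\<integral>\<^sup>+a\<in>B. ennreal \<bar>pullback \<phi> \<omega> a (\<lambda>k. axis k 1)\<bar> \<partial>lborel)))"

end

theory Submission
  imports Defs
begin

text \<open>Write \<open>g = L T R\<close> with \<open>L\<close>, \<open>R\<close> in the subgroup \<open>SO(4)\<close> and \<open>T = exp (a\<^sub>7 H\<^sub>1\<^sub>1) exp (a\<^sub>8 C\<^sub>5)\<close> in a
  maximal torus. Then \<open>g\<^sup>-\<^sup>1 dg = R\<^sup>-\<^sup>1 (T\<^sup>-\<^sup>1 (L\<^sup>-\<^sup>1 dL) T + T\<^sup>-\<^sup>1 dT + dR R\<^sup>-\<^sup>1) R\<close>, and conjugation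
  by \<open>R\<close> preserves the volume: it acts orthogonally, and with positive determinant because each
  exponential factor of \<open>R\<close> is a square. \<open>L\<^sup>-\<^sup>1 dL\<close> and \<open>dR R\<^sup>-\<^sup>1\<close> are given by Euler angles in two commuting \<open>su(2)\<close> factors, each
  contributing the sine of its middle angle. In the basis of \<open>so(4)\<close> adapted to the six positive
  roots, conjugation by \<open>T\<close> rotates each root vector by the value of its root towards the
  complement of \<open>so(4)\<close>, which contributes the product of sines \<open>f\<close>.\<close>

section \<open>The matrix exponential\<close>

text \<open>The factorization is a Cartan decomposition for the symmetric pair of \<open>G2\<close>
  and SO(4). Its rank 2 equals the rank of the group, so every root has multiplicity one and nothing
  in so(4) commutes with the whole torus: this is why 6 + 2 + 6 parameters match dimension 14 and
  why each positive root contributes exactly one sine. One obstacle is that \<open>lie_G2\<close> is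
  given through exponentials, from which closure under addition cannot be read off. Linearity is
  taken from the spanning condition on the basis \<open>C\<close>; explicit elements enter because
  octonion derivations exponentiate to automorphisms. Origin of the constant: the squared lengths of
  \<open>lie_basis\<close> have product 108^2 * 3. This product is the coefficient of the torus
  determinant; dividing by its square root to normalize the basis leaves 108 * sqrt 3. Passing from
  the two su(2) triples to root vectors contributes 1/4, hence 27 * sqrt 3.\<close>

lemma matpow_0 [simp]: "matpow M 0 = mat 1"
  by (simp add: matpow_def)

lemma matpow_Suc: "matpow M (Suc k) = M ** matpow M k"
  by (simp add: matpow_def)

lemma scaleR_matrix_mult_left: "(c *\<^sub>R M) ** N = c *\<^sub>R (M ** N)" for M :: "real^'n^'m"
  by (simp add: matrix_matrix_mult_def vec_eq_iff sum_distrib_left mult_ac)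

lemma matrix_mult_scaleR_right: "M ** (c *\<^sub>R N) = c *\<^sub>R (M ** N)" for M :: "real^'n^'m"
  by (simp add: matrix_matrix_mult_def vec_eq_iff sum_distrib_left mult_ac)

lemma matrix_mult_add_left: "(M + N) ** P = M ** P + N ** P" for M :: "real^'n^'m"
  by (simp add: matrix_matrix_mult_def vec_eq_iff sum.distrib algebra_simps)

lemma matrix_mult_diff_left: "(M - N) ** P = M ** P - N ** P" for M :: "real^'n^'m"
  by (simp add: matrix_matrix_mult_def vec_eq_iff sum_subtractf algebra_simps)

lemma matrix_mult_diff_right: "M ** (N - P) = M ** N - M ** P" for M :: "real^'n^'m"
  by (simp add: matrix_matrix_mult_def vec_eq_iff sum_subtractf algebra_simps)

lemma bounded_bilinear_matrix_mult:
  "bounded_bilinear ((**) :: real^'n^'m \<Rightarrow> real^'p^'n \<Rightarrow> real^'p^'m)"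
  unfolding bilinear_conv_bounded_bilinear [symmetric]
  by (auto simp: bilinear_def matrix_add_ldistrib matrix_mult_add_left scaleR_matrix_mult_left
      matrix_mult_scaleR_right intro!: linearI)

lemma matrix_mult_minus_left: "(- M) ** N = - (M ** N)" for M :: "real^'n^'m"
  using scaleR_matrix_mult_left [of "-1" M N] by simp

lemma matrix_mult_minus_right: "M ** (- N) = - (M ** N)" for M :: "real^'n^'m"
  using matrix_mult_scaleR_right [of M "-1" N] by simp

lemmas matrix_bilinear_simps =
  matrix_add_ldistrib matrix_mult_add_left scaleR_matrix_mult_left matrix_mult_scaleR_right
  matrix_mult_minus_left matrix_mult_minus_right matrix_mult_diff_left matrix_mult_diff_right

lemma matpow_scaleR: "matpow (t *\<^sub>R M) k = t ^ k *\<^sub>R matpow M k"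
  by (induction k) (simp_all add: matpow_Suc matrix_bilinear_simps mult.commute)

lemma matpow_commute: "matpow M k ** M = M ** matpow M k"
  by (induction k) (simp_all add: matpow_Suc flip: matrix_mul_assoc)

lemma matpow_entry_bound:
  fixes M :: "real^'n^'n"
  obtains c where "\<And>k i j. \<bar>matpow M k $ i $ j\<bar> \<le> c ^ k"
proof
  fix k i j
  define b where "b = norm M"
  have b: "\<bar>M $ i $ j\<bar> \<le> b" for i j
    using component_le_norm_cart [of "M $ i" j] Finite_Cartesian_Product.norm_nth_le [of M i]
    unfolding b_def by linarith
  show "\<bar>matpow M k $ i $ j\<bar> \<le> (real CARD('n) * b) ^ k"
  proof (induction k arbitrary: i j)
    case 0
    then show ?case by (simp add: mat_def)
  next
    case (Suc k)
    have "\<bar>matpow M (Suc k) $ i $ j\<bar> \<le> (\<Sum>l\<in>UNIV. \<bar>M $ i $ l * matpow M k $ l $ j\<bar>)"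
      by (simp add: matpow_Suc matrix_matrix_mult_def)
    also have "\<dots> \<le> (\<Sum>l\<in>(UNIV::'n set). b * (real CARD('n) * b) ^ k)"
      unfolding abs_mult by (intro sum_mono mult_mono b Suc.IH) (auto simp: b_def)
    finally show ?case by (simp add: mult_ac)
  qed
qed

text \<open>Each entry is treated as a real power series in \<open>t\<close>, so that termwise
  differentiation later yields the derivative of the exponential.\<close>

lemma summable_mexp_entry: "summable (\<lambda>k. matpow M k $ i $ j / fact k * t ^ k)"
proof -
  obtain c where c: "\<And>k i j. \<bar>matpow M k $ i $ j\<bar> \<le> c ^ k"
    using matpow_entry_bound by blast
  have "summable (\<lambda>k. inverse (fact k) * (c * \<bar>t\<bar>) ^ k :: real)"
    by (rule summable_exp)
  then show ?thesis
  proof (rule summable_comparison_test')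
    fix k
    have "\<bar>matpow M k $ i $ j\<bar> * \<bar>t\<bar> ^ k \<le> c ^ k * \<bar>t\<bar> ^ k"
      by (intro mult_right_mono c) auto
    then show "norm (matpow M k $ i $ j / fact k * t ^ k) \<le> inverse (fact k) * (c * \<bar>t\<bar>) ^ k"
      by (simp add: abs_mult power_abs field_simps)
  qed
qed

lemma mexp_sums_vec:
  "(\<lambda>k. (1 / fact k) *\<^sub>R matpow (t *\<^sub>R M) k) sums
   (\<chi> i j. \<Sum>k. matpow M k $ i $ j / fact k * t ^ k)"
  unfolding sums_def
proof (intro vec_tendstoI)
  fix i j
  have "(\<lambda>n. \<Sum>k<n. matpow M k $ i $ j / fact k * t ^ k) \<longlonglongrightarrow>
      (\<Sum>k. matpow M k $ i $ j / fact k * t ^ k)"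
    using summable_LIMSEQ summable_mexp_entry by blast
  then show "(\<lambda>n. (\<Sum>k<n. (1 / fact k) *\<^sub>R matpow (t *\<^sub>R M) k) $ i $ j) \<longlonglongrightarrow>
      (\<chi> i j. \<Sum>k. matpow M k $ i $ j / fact k * t ^ k) $ i $ j"
    by (simp add: matpow_scaleR mult.commute)
qed

lemma mexp_scaleR_nth:
  "mexp (t *\<^sub>R M) $ i $ j = (\<Sum>k. matpow M k $ i $ j / fact k * t ^ k)"
  using mexp_sums_vec [of t M] by (simp add: mexp_def sums_iff)

lemma mexp_sums: "(\<lambda>k. (1 / fact k) *\<^sub>R matpow M k) sums mexp M"
  using mexp_sums_vec [of 1 M] by (simp add: mexp_def sums_iff)

lemma mexp_0 [simp]: "mexp 0 = mat 1"
proof -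
  have "mexp (0 *\<^sub>R (0::real^'a^'a)) $ i $ j = mat 1 $ i $ j" for i j
    unfolding mexp_scaleR_nth
    using powser_sums_zero [of "\<lambda>k. matpow (0::real^'a^'a) k $ i $ j / fact k"]
    by (simp add: sums_iff)
  then show ?thesis by (simp add: vec_eq_iff)
qed

lemma mexp_commute: "mexp M ** M = M ** mexp M"
proof -
  have "(\<lambda>k. ((1 / fact k) *\<^sub>R matpow M k) ** M) sums (mexp M ** M)"
    by (intro bounded_linear.sums [OF _ mexp_sums]
        bounded_bilinear.bounded_linear_left [OF bounded_bilinear_matrix_mult])
  moreover have "(\<lambda>k. M ** ((1 / fact k) *\<^sub>R matpow M k)) sums (M ** mexp M)"
    by (intro bounded_linear.sums [OF _ mexp_sums]
        bounded_bilinear.bounded_linear_right [OF bounded_bilinear_matrix_mult])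
  ultimately show ?thesis
    by (simp add: matrix_bilinear_simps matpow_commute sums_iff)
qed

lemma has_real_derivative_mexp_entry:
  "((\<lambda>t. mexp (t *\<^sub>R M) $ i $ j) has_real_derivative (M ** mexp (t *\<^sub>R M)) $ i $ j) (at t)"
proof -
  let ?c = "\<lambda>k. matpow M k $ i $ j / fact k"
  have "((\<lambda>t. \<Sum>k. ?c k * t ^ k) has_real_derivative (\<Sum>k. diffs ?c k * t ^ k)) (at t)"
    by (rule termdiffs_strong_converges_everywhere) (rule summable_mexp_entry)
  \<comment> \<open>The factor k + 1 in \<open>diffs\<close> cancels against the factorial of k + 1,
    leaving an entry of \<open>M ** matpow M k\<close> over the factorial of k.\<close>
  moreover have "diffs ?c k = (\<Sum>l\<in>UNIV. M $ i $ l * (matpow M k $ l $ j / fact k))" for k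
    by (simp add: diffs_def matpow_Suc matrix_matrix_mult_def flip: sum_divide_distrib)
  then have "(\<lambda>k. diffs ?c k * t ^ k) =
      (\<lambda>k. \<Sum>l\<in>UNIV. M $ i $ l * (matpow M k $ l $ j / fact k * t ^ k))"
    by (simp add: sum_distrib_right mult.assoc)
  then have "(\<Sum>k. diffs ?c k * t ^ k) =
      (\<Sum>l\<in>UNIV. M $ i $ l * (\<Sum>k. matpow M k $ l $ j / fact k * t ^ k))"
    by (simp only:) (intro sums_unique [symmetric] sums_sum sums_mult summable_sums
        summable_mexp_entry)
  ultimately show ?thesis
    by (simp add: mexp_scaleR_nth matrix_matrix_mult_def)
qed

lemma has_vector_derivative_vecI:
  fixes f :: "real \<Rightarrow> real^'n^'m"
  assumes "\<And>i j. ((\<lambda>t. f t $ i $ j) has_real_derivative f' $ i $ j) (at t)"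
  shows "(f has_vector_derivative f') (at t)"
proof -
  have "((\<lambda>y. (f y - f t - (y - t) *\<^sub>R f') /\<^sub>R norm (y - t)) \<longlongrightarrow> 0) (at t)"
  proof (intro vec_tendstoI)
    fix i j
    have "((\<lambda>t. f t $ i $ j) has_derivative (\<lambda>h. h * f' $ i $ j)) (at t)"
      using assms [of i j] by (simp add: has_field_derivative_def mult_commute_abs)
    then show "((\<lambda>y. ((f y - f t - (y - t) *\<^sub>R f') /\<^sub>R norm (y - t)) $ i $ j) \<longlongrightarrow> 0 $ i $ j) (at t)"
      by (simp add: has_derivative_def)
  qed
  then show ?thesis
    by (simp add: has_vector_derivative_def has_derivative_def
        bounded_linear_scaleR_left)
qed

lemma has_vector_derivative_mexp:
  "((\<lambda>t. mexp (t *\<^sub>R M)) has_vector_derivative M ** mexp (t *\<^sub>R M)) (at t)"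
  by (rule has_vector_derivative_vecI) (rule has_real_derivative_mexp_entry)

lemmas has_vector_derivative_matrix_mult =
  bounded_bilinear.has_vector_derivative [OF bounded_bilinear_matrix_mult]

lemma mexp_scaleR_commute: "mexp (t *\<^sub>R M) ** M = M ** mexp (t *\<^sub>R M)"
proof (cases "t = 0")
  case False
  with mexp_commute [of "t *\<^sub>R M"] show ?thesis by (simp add: matrix_bilinear_simps)
qed simp

lemma has_vector_derivative_mexp_minus:
  "((\<lambda>t. mexp (- t *\<^sub>R M)) has_vector_derivative - (mexp (- t *\<^sub>R M) ** M)) (at t)"
proof -
  have "((\<lambda>t. mexp (t *\<^sub>R - M)) has_vector_derivative - M ** mexp (t *\<^sub>R - M)) (at t)"
    by (rule has_vector_derivative_mexp)
  then show ?thesis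
    using mexp_scaleR_commute [of "- t" M] by (simp add: matrix_bilinear_simps)
qed

text \<open>Plays the role of uniqueness for linear differential equations: an expression with zero
  derivative is compared at two times.\<close>

lemma has_vector_derivative_zero_imp_eq:
  fixes f :: "real \<Rightarrow> 'a::real_normed_vector"
  assumes "\<And>t. (f has_vector_derivative 0) (at t)"
  shows "f t = f s"
proof -
  obtain c where "\<And>t. f t = c"
    using has_vector_derivative_zero_constant [of UNIV f] assms by auto
  then show ?thesis by simp
qed

lemma mexp_minus_left: "mexp (- M) ** mexp M = mat 1" for M :: "real^'n^'n"
proof -
  have "((\<lambda>t. mexp (- t *\<^sub>R M) ** mexp (t *\<^sub>R M)) has_vector_derivative
      mexp (- t *\<^sub>R M) ** (M ** mexp (t *\<^sub>R M)) +
      - (mexp (- t *\<^sub>R M) ** M) ** mexp (t *\<^sub>R M)) (at t)" for t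
    by (intro has_vector_derivative_matrix_mult has_vector_derivative_mexp_minus
        has_vector_derivative_mexp)
  then have "((\<lambda>t. mexp (- t *\<^sub>R M) ** mexp (t *\<^sub>R M)) has_vector_derivative 0) (at t)" for t
    by (simp add: matrix_mult_minus_left matrix_mul_assoc)
  from has_vector_derivative_zero_imp_eq [OF this, of 1 0] show ?thesis by simp
qed

lemma mexp_minus_right: "mexp M ** mexp (- M) = mat 1" for M :: "real^'n^'n"
  using mexp_minus_left [of "- M"] by simp

text \<open>The hypotheses say that ad X rotates the plane of Y and Z. The claimed value V(t)
  therefore satisfies V' = VX - XV, so exp(tX) V(t) exp(-tX) is constant and equals V(0) =
  Y.\<close>

lemma mexp_conj_rotation:
  fixes X Y Z :: "real^'n^'n"
  assumes XY: "X ** Y - Y ** X = w *\<^sub>R Z" and XZ: "X ** Z - Z ** X = - (w *\<^sub>R Y)"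
  shows "mexp (- t *\<^sub>R X) ** Y ** mexp (t *\<^sub>R X) = cos (w * t) *\<^sub>R Y - sin (w * t) *\<^sub>R Z"
proof -
  let ?V = "\<lambda>t. cos (w * t) *\<^sub>R Y - sin (w * t) *\<^sub>R Z"
  have V: "(?V has_vector_derivative (- w * sin (w * t)) *\<^sub>R Y - (w * cos (w * t)) *\<^sub>R Z) (at t)" for t
    by (auto intro!: derivative_eq_intros simp: mult.commute)
  have XV: "X ** ?V t = ?V t ** X - ((- w * sin (w * t)) *\<^sub>R Y - (w * cos (w * t)) *\<^sub>R Z)" for t
  proof -
    have "X ** ?V t - ?V t ** X =
        cos (w * t) *\<^sub>R (X ** Y - Y ** X) - sin (w * t) *\<^sub>R (X ** Z - Z ** X)"
      by (simp add: matrix_bilinear_simps algebra_simps)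
    then show ?thesis
      unfolding XY XZ by (simp add: algebra_simps)
  qed
  have "((\<lambda>t. mexp (t *\<^sub>R X) ** (?V t ** mexp (- t *\<^sub>R X))) has_vector_derivative 0) (at t)" for t
  proof -
    have "((\<lambda>t. mexp (t *\<^sub>R X) ** (?V t ** mexp (- t *\<^sub>R X))) has_vector_derivative
       mexp (t *\<^sub>R X) ** (?V t ** - (mexp (- t *\<^sub>R X) ** X) +
          ((- w * sin (w * t)) *\<^sub>R Y - (w * cos (w * t)) *\<^sub>R Z) ** mexp (- t *\<^sub>R X))
        + (X ** mexp (t *\<^sub>R X)) ** (?V t ** mexp (- t *\<^sub>R X))) (at t)"
      by (intro has_vector_derivative_matrix_mult has_vector_derivative_mexp_minus
          has_vector_derivative_mexp V)
    moreover have cancel: "e ** (V ** - (e' ** X) + V' ** e') + (X ** e) ** (V ** e') = 0"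
      if "e ** X = X ** e" "e' ** X = X ** e'" "X ** V = V ** X - V'" for e e' V V'
    proof -
      have "(X ** e) ** (V ** e') = e ** ((X ** V) ** e')"
        by (simp add: matrix_mul_assoc that(1) [symmetric])
      then show ?thesis
        by (simp add: that(2,3) matrix_bilinear_simps matrix_mul_assoc)
    qed
    ultimately show ?thesis
      by (simp only: cancel [OF mexp_scaleR_commute [of t X] mexp_scaleR_commute [of "- t" X]
            XV [of t]])
  qed
  from has_vector_derivative_zero_imp_eq [OF this, of t 0]
  have Y: "mexp (t *\<^sub>R X) ** (?V t ** mexp (- (t *\<^sub>R X))) = Y" by simp
  have "f ** (e ** (V ** f)) ** e = (f ** e) ** V ** (f ** e)" for e f V :: "real^'n^'n"
    by (simp only: matrix_mul_assoc)
  from this [of "mexp (- (t *\<^sub>R X))" "mexp (t *\<^sub>R X)" "?V t", unfolded Y mexp_minus_left]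
  show ?thesis by simp
qed

section \<open>Octonion derivations and automorphisms\<close>

lemma exhaust_7:
  fixes x :: 7
  shows "x = 1 \<or> x = 2 \<or> x = 3 \<or> x = 4 \<or> x = 5 \<or> x = 6 \<or> x = 7"
proof (induct x)
  case (of_int z)
  then have "z = 0 \<or> z = 1 \<or> z = 2 \<or> z = 3 \<or> z = 4 \<or> z = 5 \<or> z = 6" by fastforce
  then show ?case by auto
qed

lemma forall_7: "(\<forall>i::7. P i) \<longleftrightarrow> P 1 \<and> P 2 \<and> P 3 \<and> P 4 \<and> P 5 \<and> P 6 \<and> P 7"
  by (metis exhaust_7)

lemma UNIV_7: "UNIV = {1, 2, 3, 4, 5, 6, 7::7}"
  using exhaust_7 by auto

lemma sum_7: "sum f (UNIV::7 set) = f 1 + f 2 + f 3 + f 4 + f 5 + f 6 + f 7"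
  unfolding UNIV_7 by (simp add: ac_simps)

lemma inner_im_basis: "im_basis i \<bullet> im_basis j = (if i = j then 1 else 0)"
proof -
  have "\<forall>i j. im_basis i \<bullet> im_basis j = (if i = j then 1 else 0)"
    unfolding forall_7 by (simp add: im_basis_def inner_prod_def zero_prod_def)
  then show ?thesis by blast
qed

definition oct_one :: octonion where
  "oct_one = ((1, 0, 0, 0), 0)"

definition oct_re :: "octonion \<Rightarrow> real" where
  "oct_re z = z \<bullet> oct_one"

definition oct_im :: "octonion \<Rightarrow> real ^ 7" where
  "oct_im z = (\<chi> i. z \<bullet> im_basis i)"

definition oct_of_im :: "real ^ 7 \<Rightarrow> octonion" where
  "oct_of_im v = (\<Sum>i\<in>UNIV. v $ i *\<^sub>R im_basis i)"

text \<open>A matrix on the imaginary octonions is extended to all octonions in two ways: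
  \<open>act\<close> kills 1, as a derivation does, and \<open>act1\<close> fixes 1, as an
  automorphism does.\<close>

definition act :: "real ^ 7 ^ 7 \<Rightarrow> octonion \<Rightarrow> octonion" where
  "act M z = oct_of_im (M *v oct_im z)"

definition act1 :: "real ^ 7 ^ 7 \<Rightarrow> octonion \<Rightarrow> octonion" where
  "act1 M z = oct_re z *\<^sub>R oct_one + act M z"

definition oct_derivation :: "real ^ 7 ^ 7 \<Rightarrow> bool" where
  "oct_derivation X \<longleftrightarrow>
     (\<forall>x y. act X (omul x y) = omul (act X x) y + omul x (act X y))"

lemma oct_im_of_im [simp]: "oct_im (oct_of_im v) = v"
  by (simp add: oct_im_def oct_of_im_def vec_eq_iff inner_sum_left inner_im_basis if_distrib
      cong: if_cong)

lemma oct_re_of_im [simp]: "oct_re (oct_of_im v) = 0"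
proof -
  have "\<forall>i. im_basis i \<bullet> oct_one = 0"
    unfolding forall_7 by (simp add: im_basis_def oct_one_def inner_prod_def zero_prod_def)
  then show ?thesis
    by (simp add: oct_re_def oct_of_im_def inner_sum_left)
qed

lemma oct_im_one [simp]: "oct_im oct_one = 0"
  and oct_re_one [simp]: "oct_re oct_one = 1"
  by (simp_all add: oct_im_def oct_re_def oct_one_def vec_eq_iff forall_7 im_basis_def
      inner_prod_def zero_prod_def)

lemma oct_decomp: "oct_re z *\<^sub>R oct_one + oct_of_im (oct_im z) = z"
  by (cases z)
    (auto simp: oct_re_def oct_im_def oct_of_im_def oct_one_def sum_7 im_basis_def
      inner_prod_def zero_prod_def)

lemma linear_oct_re: "linear oct_re"
  by (intro linearI) (simp_all add: oct_re_def inner_add_left)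

lemma linear_oct_im: "linear oct_im"
  by (intro linearI) (simp_all add: oct_im_def inner_add_left vec_eq_iff)

lemma linear_oct_of_im: "linear oct_of_im"
  by (intro linearI) (simp_all add: oct_of_im_def scaleR_left_distrib sum.distrib scaleR_sum_right)

lemmas oct_linear_simps =
  linear_add [OF linear_oct_re] linear_add [OF linear_oct_im] linear_add [OF linear_oct_of_im]
  linear_scale [OF linear_oct_re] linear_scale [OF linear_oct_im] linear_scale [OF linear_oct_of_im]
  linear_neg [OF linear_oct_of_im] linear_0 [OF linear_oct_of_im]

lemma bounded_bilinear_act: "bounded_bilinear act"
  unfolding bilinear_conv_bounded_bilinear [symmetric] bilinear_def act_def
  by (intro conjI allI linearI) (simp_all add: oct_linear_simps matrix_vector_right_distrib
      matrix_vector_mult_add_rdistrib matrix_vector_mult_scaleR flip: scaleR_matrix_vector_assoc)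

interpretation act: bounded_bilinear act
  by (rule bounded_bilinear_act)

lemma bounded_bilinear_omul: "bounded_bilinear omul"
  unfolding bilinear_conv_bounded_bilinear [symmetric] bilinear_def
  by (auto intro!: linearI simp: algebra_simps split_paired_all)

interpretation omul: bounded_bilinear omul
  by (rule bounded_bilinear_omul)

lemma act_mult: "act (M ** N) z = act M (act N z)"
  by (simp add: act_def matrix_vector_mul_assoc)

lemma oct_re_act [simp]: "oct_re (act M z) = 0"
  by (simp add: act_def)

lemma act_one [simp]: "act M oct_one = 0"
  by (simp add: act_def oct_linear_simps)

lemma act_act1: "act M (act1 N z) = act (M ** N) z"
  by (simp add: act1_def act.add_right act.scaleR_right act_mult)

lemma oct_re_act1 [simp]: "oct_re (act1 M z) = oct_re z"
  by (simp add: act1_def oct_linear_simps)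

lemma act1_mult: "act1 (M ** N) z = act1 M (act1 N z)"
  by (simp add: act1_def [of M] act1_def [of "M ** N"] act_act1)

lemma act1_mat_1 [simp]: "act1 (mat 1) z = z"
  by (simp add: act1_def act_def oct_decomp)

lemma linear_act1: "linear (act1 M)"
  by (intro linearI) (simp_all add: act1_def oct_linear_simps act.add_right act.scaleR_right
      algebra_simps)

lemma act1_im_basis: "act1 M (im_basis j) = (\<Sum>i\<in>UNIV. M $ i $ j *\<^sub>R im_basis i)"
proof -
  have "im_basis j = oct_of_im (axis j 1)"
    by (simp add: oct_of_im_def axis_def if_distrib [of "\<lambda>c. c *\<^sub>R _"] cong: if_cong)
  then have "oct_re (im_basis j) = 0" "oct_im (im_basis j) = axis j 1"
    by simp_all
  then show ?thesis
    by (simp add: act1_def act_def matrix_vector_mul_component oct_of_im_def inner_axis)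
qed

lemma in_G2I:
  assumes "M ** N = mat 1" "N ** M = mat 1"
    and "\<And>x y. act1 M (omul x y) = omul (act1 M x) (act1 M y)"
  shows "M \<in> G2"
proof -
  have "bij (act1 M)"
  proof (rule o_bij)
    show "act1 N \<circ> act1 M = id" "act1 M \<circ> act1 N = id"
      by (simp_all add: fun_eq_iff assms flip: act1_mult)
  qed
  then have "octonion_automorphism (act1 M)"
    using assms(3) linear_act1 by (simp add: octonion_automorphism_def)
  then show ?thesis
    unfolding G2_def using act1_im_basis by blast
qed

lemma G2_mult:
  assumes "M \<in> G2" "N \<in> G2"
  shows "M ** N \<in> G2"
proof -
  obtain f g where f: "octonion_automorphism f" "\<And>j. f (im_basis j) = (\<Sum>i\<in>UNIV. (M $ i $ j) *\<^sub>R im_basis i)"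
    and g: "octonion_automorphism g" "\<And>j. g (im_basis j) = (\<Sum>i\<in>UNIV. (N $ i $ j) *\<^sub>R im_basis i)"
    using assms by (auto simp: G2_def)
  have "octonion_automorphism (f \<circ> g)"
    using f(1) g(1) by (simp add: octonion_automorphism_def linear_compose bij_comp del: split_paired_All)
  moreover have "(f \<circ> g) (im_basis j) = (\<Sum>i\<in>UNIV. ((M ** N) $ i $ j) *\<^sub>R im_basis i)" for j
  proof -
    have "linear f" using f(1) by (simp add: octonion_automorphism_def)
    then have "(f \<circ> g) (im_basis j) = (\<Sum>k\<in>UNIV. \<Sum>i\<in>UNIV. (N $ k $ j * M $ i $ k) *\<^sub>R im_basis i)"
      by (simp add: g(2) f(2) linear_sum linear_scale scaleR_sum_right)
    also have "\<dots> = (\<Sum>i\<in>UNIV. \<Sum>k\<in>UNIV. (N $ k $ j * M $ i $ k) *\<^sub>R im_basis i)"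
      by (rule sum.swap)
    finally show ?thesis
      by (simp add: matrix_matrix_mult_def scaleR_sum_left mult.commute)
  qed
  ultimately show ?thesis unfolding G2_def by blast
qed

lemma act1_mexp_derivative:
  "((\<lambda>t. act1 (mexp (t *\<^sub>R X)) x) has_vector_derivative act X (act1 (mexp (t *\<^sub>R X)) x)) (at t)"
proof -
  have "((\<lambda>t. oct_re x *\<^sub>R oct_one + act (mexp (t *\<^sub>R X)) x) has_vector_derivative
      0 + act (X ** mexp (t *\<^sub>R X)) x) (at t)"
    by (intro has_vector_derivative_add has_vector_derivative_const
        bounded_linear.has_vector_derivative [OF act.bounded_linear_left] has_vector_derivative_mexp)
  then show ?thesis by (simp add: act1_def [abs_def] act.add_right act.scaleR_right act_mult)
qed

lemma mexp_derivation_in_G2: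
  assumes X: "oct_derivation X"
  shows "mexp X \<in> G2"
proof (rule in_G2I)
  show "mexp X ** mexp (- X) = mat 1" "mexp (- X) ** mexp X = mat 1"
    by (rule mexp_minus_right mexp_minus_left)+
  fix x y
  \<comment> \<open>By the Leibniz rule the product of the two moving factors solves w' = X w, the
    equation that the image of the product also solves; so moving \<open>w t\<close> back by
    \<open>mexp (- t *\<^sub>R X)\<close> gives a constant.\<close>
  define w where "w t = omul (act1 (mexp (t *\<^sub>R X)) x) (act1 (mexp (t *\<^sub>R X)) y)" for t
  have w: "(w has_vector_derivative act X (w t)) (at t)" for t
    unfolding w_def using X
      omul.has_vector_derivative [OF act1_mexp_derivative [of X x t] act1_mexp_derivative [of X y t]]
    by (simp add: oct_derivation_def add.commute del: split_paired_All)
  have "((\<lambda>t. act1 (mexp (- t *\<^sub>R X)) (w t)) has_vector_derivative 0) (at t)" for t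
  proof -
    have "((\<lambda>t. oct_re (w t) *\<^sub>R oct_one + act (mexp (- t *\<^sub>R X)) (w t)) has_vector_derivative
        (oct_re (act X (w t)) *\<^sub>R oct_one +
          (act (mexp (- t *\<^sub>R X)) (act X (w t)) + act (- (mexp (- t *\<^sub>R X) ** X)) (w t)))) (at t)"
      by (intro has_vector_derivative_add w has_vector_derivative_mexp_minus
          act.has_vector_derivative
          bounded_linear.has_vector_derivative [OF bounded_linear_scaleR_left]
          bounded_linear.has_vector_derivative [OF linear_oct_re [unfolded linear_conv_bounded_linear]])
    then show ?thesis by (simp add: act1_def [abs_def] act.minus_left act_mult)
  qed
  from has_vector_derivative_zero_imp_eq [OF this, of 1 0]
  have "act1 (mexp (- X)) (w 1) = omul x y" by (simp add: w_def)
  then have "act1 (mexp X) (omul x y) = act1 (mexp X ** mexp (- X)) (w 1)"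
    by (simp add: act1_mult)
  then show "act1 (mexp X) (omul x y) = omul (act1 (mexp X) x) (act1 (mexp X) y)"
    by (simp add: mexp_minus_right w_def)
qed

lemma oct_derivation_scaleR: "oct_derivation X \<Longrightarrow> oct_derivation (c *\<^sub>R X)"
  by (simp add: oct_derivation_def act.scaleR_left omul.scaleR_left omul.scaleR_right
      scaleR_right_distrib del: split_paired_All)

lemma oct_derivation_in_lie_G2: "oct_derivation X \<Longrightarrow> X \<in> lie_G2"
  by (simp add: lie_G2_def mexp_derivation_in_G2 oct_derivation_scaleR)

section \<open>A root basis of the Lie algebra\<close>

lemma exhaust_14:
  fixes x :: 14
  shows "x = 1 \<or> x = 2 \<or> x = 3 \<or> x = 4 \<or> x = 5 \<or> x = 6 \<or> x = 7 \<or>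
    x = 8 \<or> x = 9 \<or> x = 10 \<or> x = 11 \<or> x = 12 \<or> x = 13 \<or> x = 14"
proof (induct x)
  case (of_int z)
  then have "z = 0 \<or> z = 1 \<or> z = 2 \<or> z = 3 \<or> z = 4 \<or> z = 5 \<or> z = 6 \<or>
    z = 7 \<or> z = 8 \<or> z = 9 \<or> z = 10 \<or> z = 11 \<or> z = 12 \<or> z = 13"
    by simp presburger
  then show ?case by auto
qed

lemma forall_14: "(\<forall>i::14. P i) \<longleftrightarrow> P 1 \<and> P 2 \<and> P 3 \<and> P 4 \<and> P 5 \<and> P 6 \<and> P 7 \<and>
    P 8 \<and> P 9 \<and> P 10 \<and> P 11 \<and> P 12 \<and> P 13 \<and> P 14"
  by (metis exhaust_14)

lemma UNIV_14: "UNIV = {1, 2, 3, 4, 5, 6, 7, 8, 9, 10, 11, 12, 13, 14::14}"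
  using exhaust_14 by auto

lemma E_mult: "E i j ** E k l = of_bool (j = k) *\<^sub>R E i l"
proof -
  have "(\<Sum>n\<in>UNIV. (if r = i \<and> n = j then 1 else 0) * (if n = k \<and> c = l then 1 else 0 :: real)) =
     (\<Sum>n\<in>UNIV. if n = j then (if r = i \<and> j = k \<and> c = l then 1 else 0) else 0)" for r c
    by (intro sum.cong) auto
  then show ?thesis
    by (auto simp: E_def matrix_matrix_mult_def vec_eq_iff)
qed

lemma trace_E: "trace (E i j) = of_bool (i = j)"
proof -
  have "trace (E i j) = (\<Sum>r\<in>UNIV. if r = i then of_bool (i = j) else 0)"
    unfolding trace_def E_def by (intro sum.cong) auto
  then show ?thesis by simp
qed

lemma trace_scaleR: "trace (c *\<^sub>R M) = c * trace M" for M :: "real^'n^'n"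
  by (simp add: trace_def sum_distrib_left)

definition comm :: "real^'n^'n \<Rightarrow> real^'n^'n \<Rightarrow> real^'n^'n" where
  "comm X Y = X ** Y - Y ** X"

lemma bounded_bilinear_comm: "bounded_bilinear comm"
  unfolding bilinear_conv_bounded_bilinear [symmetric] bilinear_def comm_def
  by (intro conjI allI linearI) (simp_all add: matrix_bilinear_simps algebra_simps)

interpretation comm: bounded_bilinear comm
  by (rule bounded_bilinear_comm)

lemma bounded_bilinear_ip: "bounded_bilinear ip"
  unfolding bilinear_conv_bounded_bilinear [symmetric] bilinear_def ip_def
  by (intro conjI allI linearI)
    (simp_all add: matrix_bilinear_simps trace_add trace_def sum.distrib sum_distrib_left algebra_simps)

interpretation ip: bounded_bilinear ip
  by (rule bounded_bilinear_ip)

lemma comm_A: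
  "comm (A i j) (A k l) =
     of_bool (j = k) *\<^sub>R A i l - of_bool (i = k) *\<^sub>R A j l -
     of_bool (j = l) *\<^sub>R A i k + of_bool (i = l) *\<^sub>R A j k"
proof -
  \<comment> \<open>Orients the index equations uniformly, so that Kronecker symbols from the two
    products can cancel.\<close>
  have eqs: "(k = j) = (j = k)" "(k = i) = (i = k)" "(l = j) = (j = l)" "(l = i) = (i = l)"
    by auto
  show ?thesis
    by (simp add: comm_def A_def matrix_bilinear_simps E_mult eqs
        scaleR_right_diff_distrib)
qed

lemma ip_A:
  "ip (A i j) (A k l) = (of_bool (i = k \<and> j = l) - of_bool (i = l \<and> j = k)) / 2"
proof -
  have eqs: "(k = j) = (j = k)" "(k = i) = (i = k)" "(l = j) = (j = l)" "(l = i) = (i = l)"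
    by auto
  show ?thesis
    by (simp add: ip_def A_def matrix_bilinear_simps E_mult trace_add trace_sub trace_scaleR trace_E eqs
        of_bool_conj mult.commute)
qed

lemma act_A: "act (A i j) z = oct_im z $ j *\<^sub>R im_basis i - oct_im z $ i *\<^sub>R im_basis j"
proof -
  have oct_of_im_axis: "oct_of_im (axis i 1) = im_basis i" for i
    by (simp add: oct_of_im_def axis_def if_distrib [of "\<lambda>c. c *\<^sub>R _"] cong: if_cong)
  have "act (E i j) z = oct_im z $ j *\<^sub>R im_basis i" for i j
  proof -
    have "E i j *v oct_im z = oct_im z $ j *\<^sub>R axis i 1"
      by (auto simp: E_def matrix_vector_mult_def vec_eq_iff axis_def if_distrib
          [of "\<lambda>c. c * _"] cong: if_cong conj_cong)
    then show ?thesis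
      by (simp add: act_def oct_linear_simps oct_of_im_axis)
  qed
  then show ?thesis by (simp add: A_def act.diff_left)
qed

text \<open>\<open>H\<^sub>i\<close> is \<open>sqrt 3\<close> times \<open>C\<^sub>i\<close>. The triples \<open>C\<^sub>3, C\<^sub>2, C\<^sub>1\<close> and \<open>H\<^sub>8, H\<^sub>9, H\<^sub>1\<^sub>0\<close> span the two \<open>su(2)\<close> factors.\<close>

definition C1 :: "real^7^7" where "C1 = A 4 7 + A 5 6"
definition H8 :: "real^7^7" where "H8 = - 2 *\<^sub>R A 2 3 + A 4 5 - A 6 7"
definition H9 :: "real^7^7" where "H9 = - 2 *\<^sub>R A 1 2 + A 4 7 - A 5 6"
definition H10 :: "real^7^7" where "H10 = - 2 *\<^sub>R A 1 3 - A 4 6 - A 5 7"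
definition H11 :: "real^7^7" where "H11 = - 2 *\<^sub>R A 1 4 - A 2 7 + A 3 6"

text \<open>An orthogonal basis: \<open>1, \<dots>, 6\<close> span the part of the orthogonal complement of \<open>so(4)\<close> on which
  the torus acts nontrivially, \<open>7, 8\<close> the torus, and \<open>9, \<dots>, 14\<close> span \<open>so(4)\<close>.\<close>

definition lie_basis :: "14 \<Rightarrow> real^7^7" where
  "lie_basis i =
     (if i = 1 then 2 *\<^sub>R A 1 5 - A 2 6 - A 3 7
      else if i = 2 then A 1 7 + A 2 4 + 2 *\<^sub>R A 3 5 - (A 1 6 + 2 *\<^sub>R A 2 5 - A 3 4)
      else if i = 3 then A 1 7 + A 2 4 + 2 *\<^sub>R A 3 5 + (A 1 6 + 2 *\<^sub>R A 2 5 - A 3 4)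
      else if i = 4 then A 2 7 + A 3 6
      else if i = 5 then A 2 4 - A 1 7 - (A 1 6 + A 3 4)
      else if i = 6 then A 2 4 - A 1 7 + (A 1 6 + A 3 4)
      else if i = 7 then H11 else if i = 8 then C5
      else if i = 9 then C3 else if i = 10 then C2 else if i = 11 then C1
      else if i = 12 then H8 else if i = 13 then H9 else H10)"

text \<open>These are squared \<open>ip\<close>-lengths.\<close>

definition lie_norm :: "14 \<Rightarrow> real" where
  "lie_norm i =
     (if i = 1 then 3 else if i = 2 then 6 else if i = 3 then 6 else if i = 4 then 1
      else if i = 5 then 2 else if i = 6 then 2 else if i = 7 then 3 else if i = 8 then 1
      else if i = 9 then 1 else if i = 10 then 1 else if i = 11 then 1 else 3)"

text \<open>The element of \<open>so(4)\<close> in the real root plane that contains \<open>lie_basis i\<close>; only \<open>i = 1, \<dots>, 6\<close>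
  is meaningful. The root takes the values \<open>root_H11 i\<close> and \<open>root_C5 i\<close> on the torus generators.\<close>

definition root_vec :: "14 \<Rightarrow> real^7^7" where
  "root_vec i =
     (if i = 1 then A 2 3 - 2 *\<^sub>R A 4 5 - A 6 7
      else if i = 2 then A 4 6 - A 1 3 - 2 *\<^sub>R A 5 7 - (A 1 2 + A 4 7 + 2 *\<^sub>R A 5 6)
      else if i = 3 then A 4 6 - A 1 3 - 2 *\<^sub>R A 5 7 + (A 1 2 + A 4 7 + 2 *\<^sub>R A 5 6)
      else if i = 4 then - A 2 3 - A 6 7
      else if i = 5 then A 1 3 + A 4 6 + (A 4 7 - A 1 2)
      else A 1 3 + A 4 6 - (A 4 7 - A 1 2))"

definition root_H11 :: "14 \<Rightarrow> real" where
  "root_H11 i = (if i = 1 then 2 else if i = 2 then 1 else if i = 3 then - 1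
     else if i = 4 then 0 else if i = 5 then 3 else - 3)"

definition root_C5 :: "14 \<Rightarrow> real" where
  "root_C5 i = (if i = 1 then 0 else if i = 4 then 2 else 1)"

lemmas lie_defs = C1_def C2_def C3_def C5_def H8_def H9_def H10_def H11_def

lemmas comm_simps = comm_A comm.add_left comm.add_right comm.diff_left comm.diff_right
  comm.scaleR_left comm.scaleR_right comm.minus_left comm.minus_right

lemmas ip_simps = ip_A ip.add_left ip.add_right ip.diff_left ip.diff_right
  ip.scaleR_left ip.scaleR_right ip.minus_left ip.minus_right

text \<open>An su(2) triple with all structure constants 2, whence the doubled Euler angles; the
  rescaling from \<open>C8\<close>, \<open>C9\<close> to \<open>H8\<close>, \<open>H9\<close> gives
  the second triple the same constants. Entries are compared at the end because \<open>A i j\<close>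
  and \<open>- A j i\<close> are different terms for one matrix.\<close>

lemma comm_s:
  "comm C3 C2 = 2 *\<^sub>R C1" "comm C3 C1 = - (2 *\<^sub>R C2)" "comm C2 C1 = 2 *\<^sub>R C3"
  by (simp add: lie_defs comm_simps; simp add: vec_eq_iff forall_7 A_def E_def)+

lemma comm_sigma:
  "comm H8 H9 = 2 *\<^sub>R H10" "comm H8 H10 = - (2 *\<^sub>R H9)" "comm H9 H10 = 2 *\<^sub>R H8"
  by (simp add: lie_defs comm_simps; simp add: vec_eq_iff forall_7 A_def E_def)+

lemma comm_s_sigma:
  "comm C3 H8 = 0" "comm C3 H9 = 0" "comm C3 H10 = 0"
  "comm C2 H8 = 0" "comm C2 H9 = 0" "comm C2 H10 = 0"
  by (simp add: lie_defs comm_simps; simp add: vec_eq_iff forall_7 A_def E_def)+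

lemma comm_H11_C5: "comm H11 C5 = 0"
  by (simp add: lie_defs comm_simps; simp add: vec_eq_iff forall_7 A_def E_def)+

text \<open>Each torus generator rotates each root plane, which is the hypothesis of
  \<open>Ad_rotation\<close>. As \<open>H11\<close> and \<open>C5\<close> are orthogonal of squared
  lengths 3 and 1, roots 1, 2, 3 have squared length 4/3 and roots 4, 5, 6 have squared length 4:
  the short and the long positive roots.\<close>

lemma comm_root_vec:
  assumes "i \<in> {1, 2, 3, 4, 5, 6}"
  shows "comm H11 (root_vec i) = root_H11 i *\<^sub>R lie_basis i"
    and "comm H11 (lie_basis i) = - (root_H11 i *\<^sub>R root_vec i)"
    and "comm C5 (root_vec i) = root_C5 i *\<^sub>R lie_basis i"
    and "comm C5 (lie_basis i) = - (root_C5 i *\<^sub>R root_vec i)"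
  using assms
  by (elim insertE emptyE; hypsubst;
      simp add: lie_basis_def root_vec_def root_H11_def root_C5_def lie_defs comm_simps;
      simp add: vec_eq_iff forall_7 A_def E_def)+

text \<open>The right sides are nested so that every change of vectors involves only two at a time,
  in the shape that \<open>wedge_upd2\<close> expects.\<close>

lemma mix_root_vec:
  "C3 = (1 / 2) *\<^sub>R root_vec 4 + (1 / 2) *\<^sub>R root_vec 1"
  "H8 = (3 / 2) *\<^sub>R root_vec 4 + (- 1 / 2) *\<^sub>R root_vec 1"
  "C2 = (1 / 2) *\<^sub>R ((1 / 2) *\<^sub>R root_vec 5 + (1 / 2) *\<^sub>R root_vec 6) +
    (1 / 2) *\<^sub>R ((1 / 2) *\<^sub>R root_vec 3 + (1 / 2) *\<^sub>R root_vec 2)"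
  "H10 = (- 3 / 2) *\<^sub>R ((1 / 2) *\<^sub>R root_vec 5 + (1 / 2) *\<^sub>R root_vec 6) +
    (1 / 2) *\<^sub>R ((1 / 2) *\<^sub>R root_vec 3 + (1 / 2) *\<^sub>R root_vec 2)"
  "C1 = (1 / 2) *\<^sub>R ((1 / 2) *\<^sub>R root_vec 5 + (- 1 / 2) *\<^sub>R root_vec 6) +
    (1 / 2) *\<^sub>R ((1 / 2) *\<^sub>R root_vec 3 + (- 1 / 2) *\<^sub>R root_vec 2)"
  "H9 = (3 / 2) *\<^sub>R ((1 / 2) *\<^sub>R root_vec 5 + (- 1 / 2) *\<^sub>R root_vec 6) +
    (- 1 / 2) *\<^sub>R ((1 / 2) *\<^sub>R root_vec 3 + (- 1 / 2) *\<^sub>R root_vec 2)"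
  by (simp_all add: root_vec_def lie_defs vec_eq_iff forall_7 A_def E_def)

text \<open>The root vectors in so(4) are block diagonal for the index sets {1, 2, 3} and {4, 5, 6,
  7}, while the first eight basis elements only mix the two sets.\<close>

lemma ip_lie_basis_root_vec:
  assumes "i \<in> {1, 2, 3, 4, 5, 6, 7, 8}" and "j \<in> {1, 2, 3, 4, 5, 6}"
  shows "ip (lie_basis i) (root_vec j) = 0"
proof -
  have "\<forall>i\<in>{1, 2, 3, 4, 5, 6, 7, 8}. \<forall>j\<in>{1, 2, 3, 4, 5, 6}. ip (lie_basis i) (root_vec j) = 0"
    by (simp add: lie_basis_def root_vec_def lie_defs ip_simps)
  then show ?thesis using assms by blast
qed

text \<open>In coordinates the Leibniz rule is a polynomial identity in the 16 real components of
  two octonions, checked for each basis element.\<close>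

lemma oct_derivation_lie_basis: "oct_derivation (lie_basis i)"
proof -
  have "\<forall>i. oct_derivation (lie_basis i)"
    unfolding forall_14
    by (intro conjI; unfold oct_derivation_def split_paired_all;
        simp add: lie_basis_def lie_defs act.add_left act.diff_left act.minus_left act.scaleR_left
        act_A oct_im_def im_basis_def inner_prod_def zero_prod_def; simp add: algebra_simps)
  then show ?thesis by blast
qed

lemma ip_lie_basis: "ip (lie_basis i) (lie_basis j) = (if i = j then lie_norm i else 0)"
proof -
  have "\<forall>i j. ip (lie_basis i) (lie_basis j) = (if i = j then lie_norm i else 0)"
    unfolding forall_14 by (simp add: lie_basis_def lie_defs ip_simps lie_norm_def)
  then show ?thesis by blast
qed

section \<open>Determinants and the adjoint action\<close>

text \<open>The vectors are the columns of the determinant; transposition turns them into rows,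
  where \<open>det_row_add\<close> and \<open>det_row_mul\<close> apply.\<close>

lemma wedge_upd:
  "wedge \<theta> (v(p := x)) = det (\<chi> k. if k = p then \<chi> i. \<theta> i x else \<chi> i. \<theta> i (v k))"
proof -
  have eq: "transpose (\<chi> i k. \<theta> i ((v(p := x)) k)) =
      (\<chi> k. if k = p then \<chi> i. \<theta> i x else \<chi> i. \<theta> i (v k))"
    by (auto simp: transpose_def vec_eq_iff)
  show ?thesis
    unfolding wedge_def eq [symmetric] by (rule det_transpose [symmetric])
qed

lemma wedge_upd_add:
  assumes "\<And>i. linear (\<theta> i)"
  shows "wedge \<theta> (v(p := x + y)) = wedge \<theta> (v(p := x)) + wedge \<theta> (v(p := y))"
proof -
  have eq: "(\<chi> i. \<theta> i (x + y)) = (\<chi> i. \<theta> i x) + (\<chi> i. \<theta> i y)"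
    by (simp add: vec_eq_iff linear_add [OF assms])
  show ?thesis
    unfolding wedge_upd eq by (rule det_row_add)
qed

lemma wedge_upd_scale:
  fixes v :: "'n::finite \<Rightarrow> 'v::real_vector"
  assumes "\<And>i. linear (\<theta> i)"
  shows "wedge \<theta> (v(p := c *\<^sub>R x)) = c * wedge \<theta> (v(p := x))"
proof -
  have eq: "(\<chi> i. \<theta> i (c *\<^sub>R x)) = c *s (\<chi> i. \<theta> i x)"
    by (simp add: vec_eq_iff linear_scale [OF assms])
  show ?thesis
    unfolding wedge_upd eq by (rule det_row_mul)
qed

lemma wedge_eq_0:
  assumes "p \<noteq> q" "v p = v q"
  shows "wedge \<theta> v = 0"
  unfolding wedge_def by (rule det_identical_columns [OF assms(1)]) (simp add: column_def assms(2))

lemma wedge_upd2: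
  fixes v :: "'n::finite \<Rightarrow> 'v::real_vector"
  assumes \<theta>: "\<And>i. linear (\<theta> i)" and "p \<noteq> q"
    and v: "v p = a *\<^sub>R x + b *\<^sub>R y" "v q = c *\<^sub>R x + d *\<^sub>R y"
  shows "wedge \<theta> v = (a * d - b * c) * wedge \<theta> (v(p := x, q := y))"
proof -
  define W where "W x y = wedge \<theta> (v(p := x, q := y))" for x y
  \<comment> \<open>The updates are reordered so that the slot being varied is the outermost
    one.\<close>
  have W': "W x y = wedge \<theta> (v(q := y, p := x))" for x y
    using \<open>p \<noteq> q\<close> by (simp add: W_def fun_upd_twist)
  have lin: "W (x + x') y = W x y + W x' y" "W (r *\<^sub>R x) y = r * W x y"
    "W x (y + y') = W x y + W x y'" "W x (r *\<^sub>R y) = r * W x y" for x x' y y' r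
  proof -
    show "W (x + x') y = W x y + W x' y" "W (r *\<^sub>R x) y = r * W x y"
      unfolding W' by (rule wedge_upd_add [OF \<theta>] wedge_upd_scale [OF \<theta>])+
    show "W x (y + y') = W x y + W x y'" "W x (r *\<^sub>R y) = r * W x y"
      unfolding W_def by (rule wedge_upd_add [OF \<theta>] wedge_upd_scale [OF \<theta>])+
  qed
  have alt: "W x x = 0" for x
    unfolding W_def by (rule wedge_eq_0 [OF \<open>p \<noteq> q\<close>]) simp
  \<comment> \<open>Polarization: alternation at \<open>x + y\<close> gives antisymmetry.\<close>
  have "W x y + W y x = 0"
    using alt [of "x + y"] unfolding lin by (simp add: alt)
  then have "W y x = - W x y"
    by linarith
  then have "W (a *\<^sub>R x + b *\<^sub>R y) (c *\<^sub>R x + d *\<^sub>R y) = (a * d - b * c) * W x y"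
    by (simp add: lin alt [of x] alt [of y] algebra_simps)
  then show ?thesis by (simp add: W_def flip: v)
qed

lemma wedge_upd3:
  fixes v :: "'n::finite \<Rightarrow> 'v::real_vector"
  assumes \<theta>: "\<And>i. linear (\<theta> i)" and "p \<noteq> q" "p \<noteq> r" "q \<noteq> r"
    and v: "v p = a1 *\<^sub>R x + a2 *\<^sub>R y + a3 *\<^sub>R z" "v q = b1 *\<^sub>R x + b2 *\<^sub>R y + b3 *\<^sub>R z"
      "v r = c1 *\<^sub>R x + c2 *\<^sub>R y + c3 *\<^sub>R z"
  shows "wedge \<theta> v =
    (a1 * (b2 * c3 - b3 * c2) - a2 * (b1 * c3 - b3 * c1) + a3 * (b1 * c2 - b2 * c1)) *
      wedge \<theta> (v(p := x, q := y, r := z))"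
proof -
  define W where "W x y z = wedge \<theta> (v(p := x, q := y, r := z))" for x y z
  have W': "W x y z = wedge \<theta> (v(q := y, r := z, p := x))" "W x y z = wedge \<theta> (v(p := x, r := z, q := y))"
    for x y z
    unfolding W_def using assms(2-4) by (auto intro!: arg_cong [of _ _ "wedge \<theta>"])
  have lin: "W (x + x') y z = W x y z + W x' y z" "W (k *\<^sub>R x) y z = k * W x y z"
    "W x (y + y') z = W x y z + W x y' z" "W x (k *\<^sub>R y) z = k * W x y z"
    "W x y (z + z') = W x y z + W x y z'" "W x y (k *\<^sub>R z) = k * W x y z"
    for x x' y y' z z' k
  proof -
    show "W (x + x') y z = W x y z + W x' y z" "W (k *\<^sub>R x) y z = k * W x y z"
      unfolding W'(1) by (rule wedge_upd_add [OF \<theta>] wedge_upd_scale [OF \<theta>])+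
    show "W x (y + y') z = W x y z + W x y' z" "W x (k *\<^sub>R y) z = k * W x y z"
      unfolding W'(2) by (rule wedge_upd_add [OF \<theta>] wedge_upd_scale [OF \<theta>])+
    show "W x y (z + z') = W x y z + W x y z'" "W x y (k *\<^sub>R z) = k * W x y z"
      unfolding W_def by (rule wedge_upd_add [OF \<theta>] wedge_upd_scale [OF \<theta>])+
  qed
  have alt: "W x x z = 0" "W x y x = 0" "W x y y = 0" for x y z
    unfolding W_def using assms(2-4)
    by (intro wedge_eq_0 [OF \<open>p \<noteq> q\<close>] wedge_eq_0 [OF \<open>p \<noteq> r\<close>] wedge_eq_0 [OF \<open>q \<noteq> r\<close>]; simp)+
  have "W y x z = - W x y z" "W z y x = - W x y z" "W x z y = - W x y z" for x y z
  proof -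
    have "W x y z + W y x z = 0" "W x y z + W z y x = 0" "W x y z + W x z y = 0"
      using alt(1) [of "x + y" z] alt(2) [of "x + z" y] alt(3) [of x "y + z"]
      unfolding lin by (simp_all add: alt)
    then show "W y x z = - W x y z" "W z y x = - W x y z" "W x z y = - W x y z"
      by linarith+
  qed
  then have anti: "W y x z = - W x y z" "W z y x = - W x y z" "W x z y = - W x y z"
      "W y z x = W x y z" "W z x y = W x y z"
    by metis+
  have "W (a1 *\<^sub>R x + a2 *\<^sub>R y + a3 *\<^sub>R z) (b1 *\<^sub>R x + b2 *\<^sub>R y + b3 *\<^sub>R z)
      (c1 *\<^sub>R x + c2 *\<^sub>R y + c3 *\<^sub>R z) =
    (a1 * (b2 * c3 - b3 * c2) - a2 * (b1 * c3 - b3 * c1) + a3 * (b1 * c2 - b2 * c1)) * W x y z"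
    by (simp add: lin alt anti) (simp add: algebra_simps)
  then show ?thesis by (simp add: W_def flip: v)
qed

text \<open>Ordered with \<open>S\<close> first, the matrix is block triangular with diagonal
  blocks. A permutation with a nonzero term fixes \<open>S\<close> pointwise, hence maps the
  complement to itself and fixes it too, so only the identity contributes.\<close>

lemma det_block_diagonal:
  fixes M :: "real^'n^'n"
  assumes "\<And>i j. i \<in> S \<Longrightarrow> j \<noteq> i \<Longrightarrow> M $ i $ j = 0"
    and "\<And>i j. i \<notin> S \<Longrightarrow> j \<notin> S \<Longrightarrow> j \<noteq> i \<Longrightarrow> M $ i $ j = 0"
  shows "det M = (\<Prod>i\<in>UNIV. M $ i $ i)"
proof -
  have "of_int (sign \<pi>) * (\<Prod>i\<in>UNIV. M $ i $ \<pi> i) = 0" if \<pi>: "\<pi> permutes UNIV" "\<pi> \<noteq> id" for \<pi>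
  proof -
    have "\<exists>i. M $ i $ \<pi> i = 0"
    proof (rule ccontr)
      assume "\<not> ?thesis"
      then have nz: "M $ i $ \<pi> i \<noteq> 0" for i by blast
      then have S: "\<pi> i = i" if "i \<in> S" for i
        using assms(1) that by blast
      have "\<pi> i \<notin> S" if "i \<notin> S" for i
        using S that permutes_inj [OF \<pi>(1)] by (metis injD)
      then have "\<pi> i = i" for i
        using S assms(2) nz by blast
      then show False using \<pi>(2) by auto
    qed
    then show ?thesis by simp
  qed
  then have "det M = (\<Sum>\<pi>\<in>{id}. of_int (sign \<pi>) * (\<Prod>i\<in>UNIV. M $ i $ \<pi> i))"
    unfolding det_def
    by (intro sum.mono_neutral_right) (auto simp: permutes_id finite_permutations)
  then show ?thesis by (simp add: sign_id)
qed

lemma det_orthogonal_sum: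
  fixes M :: "real^'n^'n"
  assumes "\<And>i j. (\<Sum>k\<in>UNIV. M $ k $ i * M $ k $ j) = (if i = j then 1 else 0)"
  shows "det M \<in> {1, -1}"
proof -
  have "transpose M ** M = mat 1"
    by (simp add: matrix_matrix_mult_def transpose_def vec_eq_iff mat_def assms)
  then have "det (transpose M) * det M = 1"
    by (metis det_I det_mul)
  then have "(det M)\<^sup>2 = 1"
    by (simp add: power2_eq_square)
  then show ?thesis by (simp add: power2_eq_1_iff)
qed

section \<open>Conjugation by exponentials\<close>

lemma mexp_add: "mexp ((s + t) *\<^sub>R X) = mexp (t *\<^sub>R X) ** mexp (s *\<^sub>R X)" for X :: "real^'n^'n"
proof -
  have shift: "((\<lambda>t. mexp ((s + t) *\<^sub>R X)) has_vector_derivative X ** mexp ((s + t) *\<^sub>R X)) (at t)" for t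
  proof -
    have "((\<lambda>t. s + t) has_vector_derivative 1) (at t)"
      by (auto intro!: derivative_eq_intros)
    from vector_diff_chain_at [OF this has_vector_derivative_mexp] show ?thesis
      by (simp add: o_def)
  qed
  have "((\<lambda>t. mexp (- t *\<^sub>R X) ** mexp ((s + t) *\<^sub>R X)) has_vector_derivative
      mexp (- t *\<^sub>R X) ** (X ** mexp ((s + t) *\<^sub>R X)) +
      - (mexp (- t *\<^sub>R X) ** X) ** mexp ((s + t) *\<^sub>R X)) (at t)" for t
    by (intro has_vector_derivative_matrix_mult has_vector_derivative_mexp_minus shift)
  then have "((\<lambda>t. mexp (- t *\<^sub>R X) ** mexp ((s + t) *\<^sub>R X)) has_vector_derivative 0) (at t)" for t
    by (simp add: matrix_mult_minus_left matrix_mul_assoc)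
  from has_vector_derivative_zero_imp_eq [OF this, of t 0]
  have "mexp (- (t *\<^sub>R X)) ** mexp ((s + t) *\<^sub>R X) = mexp (s *\<^sub>R X)"
    by simp
  then have "mexp (t *\<^sub>R X) ** mexp (s *\<^sub>R X) = (mexp (t *\<^sub>R X) ** mexp (- (t *\<^sub>R X))) ** mexp ((s + t) *\<^sub>R X)"
    by (metis matrix_mul_assoc)
  then show ?thesis
    by (simp add: mexp_minus_right add.commute)
qed

lemma mexp_conj:
  fixes P Q X :: "real^'n^'n"
  assumes "P ** Q = mat 1" "Q ** P = mat 1"
  shows "mexp (Q ** X ** P) = Q ** mexp X ** P"
proof -
  have "matpow (Q ** X ** P) k = Q ** matpow X k ** P" for k
  proof (induction k)
    case (Suc k)
    have "(Q ** X ** P) ** (Q ** matpow X k ** P) = Q ** X ** (P ** Q) ** matpow X k ** P"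
      by (simp only: matrix_mul_assoc)
    then show ?case by (simp add: matpow_Suc Suc assms matrix_mul_assoc)
  qed (simp add: assms)
  moreover have "(\<lambda>k. (Q ** ((1 / fact k) *\<^sub>R matpow X k)) ** P) sums (Q ** mexp X ** P)"
    by (intro bounded_linear.sums [OF bounded_bilinear.bounded_linear_left [OF bounded_bilinear_matrix_mult]]
        bounded_linear.sums [OF bounded_bilinear.bounded_linear_right [OF bounded_bilinear_matrix_mult]]
        mexp_sums)
  ultimately show ?thesis
    using mexp_sums [of "Q ** X ** P"] by (simp add: matrix_bilinear_simps sums_iff)
qed

text \<open>The adjoint action of \<open>mexp (- X)\<close>: this is how a left logarithmic
  derivative changes when the group element is multiplied on the right by
  \<open>mexp X\<close>.\<close>

definition Ad :: "real^'n^'n \<Rightarrow> real^'n^'n \<Rightarrow> real^'n^'n" where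
  "Ad X Y = mexp (- X) ** Y ** mexp X"

lemma linear_Ad: "linear (Ad X)"
  by (intro linearI) (simp_all add: Ad_def matrix_bilinear_simps)

lemma Ad_minus_cancel [simp]: "Ad (- X) (Ad X Y) = Y"
proof -
  have "mexp X ** (mexp (- X) ** Y ** mexp X) ** mexp (- X) =
      (mexp X ** mexp (- X)) ** Y ** (mexp X ** mexp (- X))"
    by (simp only: matrix_mul_assoc)
  then show ?thesis by (simp add: Ad_def mexp_minus_right)
qed

lemma ip_commute: "ip X Y = ip Y X"
  by (simp add: ip_def trace_mul_sym [of X Y])

lemma ip_Ad: "ip (Ad X Y) (Ad X Z) = ip Y Z"
proof -
  have "Ad X Y ** Ad X Z = mexp (- X) ** (Y ** (mexp X ** mexp (- X)) ** Z ** mexp X)"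
    by (simp only: Ad_def matrix_mul_assoc)
  then have "trace (Ad X Y ** Ad X Z) = trace ((Y ** Z ** mexp X) ** mexp (- X))"
    by (simp add: mexp_minus_right trace_mul_sym [of "mexp (- X)"])
  also have "(Y ** Z ** mexp X) ** mexp (- X) = Y ** Z ** (mexp X ** mexp (- X))"
    by (simp only: matrix_mul_assoc)
  finally show ?thesis by (simp add: ip_def mexp_minus_right)
qed

lemma ip_Ad_left: "ip (Ad X Y) Z = ip Y (Ad (- X) Z)"
  using ip_Ad [of X Y "Ad (- X) Z"] Ad_minus_cancel [of "- X" Z] by simp

text \<open>Conjugating a one-parameter subgroup by a group element gives a one-parameter subgroup,
  so closure of \<open>G2\<close> under products suffices.\<close>

lemma Ad_in_lie_G2:
  assumes X: "X \<in> lie_G2" and Y: "Y \<in> lie_G2"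
  shows "Ad X Y \<in> lie_G2"
proof -
  \<comment> \<open>The scalars -1 and 1 are kept because they are the instances of \<open>t\<close>
    in the definition of \<open>lie_G2\<close>.\<close>
  have "mexp (t *\<^sub>R Ad X Y) = mexp (-1 *\<^sub>R X) ** mexp (t *\<^sub>R Y) ** mexp (1 *\<^sub>R X)" for t
    using mexp_conj [OF mexp_minus_right mexp_minus_left, of X "t *\<^sub>R Y"]
    by (simp add: Ad_def matrix_bilinear_simps)
  moreover have "mexp (-1 *\<^sub>R X) \<in> G2" "mexp (1 *\<^sub>R X) \<in> G2" "mexp (t *\<^sub>R Y) \<in> G2" for t
    using X Y unfolding lie_G2_def by blast+
  ultimately show ?thesis by (simp add: lie_G2_def G2_mult)
qed

section \<open>Coordinates with respect to an orthonormal basis of the Lie algebra\<close>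

locale orthonormal_lie =
  fixes C :: "14 \<Rightarrow> real^7^7"
  assumes C: "orthonormal_basis_lie C"
begin

lemma C_lie: "C I \<in> lie_G2"
  and span_C: "span (range C) = lie_G2"
  and ip_C: "ip (C I) (C K) = (if I = K then 1 else 0)"
  using C by (auto simp: orthonormal_basis_lie_def)

text \<open>The matrices that equal their own Fourier expansion form a subspace containing every
  \<open>C I\<close>, hence contain the span.\<close>

lemma lie_expand:
  assumes "X \<in> lie_G2"
  shows "X = (\<Sum>I\<in>UNIV. ip (C I) X *\<^sub>R C I)"
proof -
  let ?S = "{X. X = (\<Sum>I\<in>UNIV. ip (C I) X *\<^sub>R C I)}"
  have "subspace ?S"
  proof (rule subspaceI)
    fix c x
    assume "x \<in> ?S"
    then have "c *\<^sub>R x = c *\<^sub>R (\<Sum>I\<in>UNIV. ip (C I) x *\<^sub>R C I)"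
      by (simp only: mem_Collect_eq)
    then show "c *\<^sub>R x \<in> ?S"
      unfolding mem_Collect_eq ip.scaleR_right scaleR_sum_right real_scaleR_def scaleR_scaleR .
  qed (auto simp: ip.zero_right ip.add_right scaleR_left_distrib sum.distrib)
  moreover have "range C \<subseteq> ?S"
    by (auto simp: ip_C if_distrib [of "\<lambda>c. c *\<^sub>R _"] cong: if_cong)
  ultimately have "span (range C) \<subseteq> ?S"
    by (rule span_minimal [rotated])
  then show ?thesis using assms span_C by auto
qed

lemma subspace_lie_G2: "subspace lie_G2"
  using span_C subspace_span by metis

lemma ip_expand:
  assumes "X \<in> lie_G2"
  shows "ip Y X = (\<Sum>I\<in>UNIV. ip (C I) X * ip Y (C I))"
  by (subst lie_expand [OF assms]) (simp add: ip.sum_right ip.scaleR_right)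

lemma inj_C: "inj C"
  using ip_C by (metis injI zero_neq_one)

lemma ip_sum_range: "ip (C K) (\<Sum>v\<in>range C. u v *\<^sub>R v) = u (C K)"
  by (simp add: sum.reindex [OF inj_C] o_def ip.sum_right ip.scaleR_right ip_C if_distrib cong: if_cong)

lemma independent_C: "independent (range C)"
proof
  assume "dependent (range C)"
  then obtain u where u: "\<exists>v\<in>range C. u v \<noteq> 0" "(\<Sum>v\<in>range C. u v *\<^sub>R v) = 0"
    using dependent_finite [of "range C"] by auto
  then show False
    using ip_sum_range [of _ u] by (auto simp: ip.zero_right)
qed

text \<open>Turns the coordinates used by \<open>left_form\<close> into inner products, which are
  invariant under \<open>Ad\<close>.\<close>

lemma representation_C:
  assumes "X \<in> lie_G2"
  shows "representation (range C) X (C I) = ip (C I) X"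
proof -
  have "(\<Sum>v\<in>range C. representation (range C) X v *\<^sub>R v) = X"
    using assms span_C independent_C by (intro sum_representation_eq) auto
  then show ?thesis
    using ip_sum_range [of I "representation (range C) X"] by simp
qed

lemma wedge_ip_Ad:
  assumes X: "X \<in> lie_G2" and f: "\<And>k. f k \<in> lie_G2"
  shows "wedge (\<lambda>I. ip (C I)) (\<lambda>k. Ad X (f k)) = wedge (\<lambda>I. ip (C I)) f"
proof -
  define P :: "real^7^7 \<Rightarrow> real^14^14" where "P X = (\<chi> I K. ip (C I) (Ad X (C K)))" for X
  \<comment> \<open>\<open>P X\<close> is the matrix of \<open>Ad X\<close> in the basis
    \<open>C\<close>. Invariance of \<open>ip\<close> moves \<open>Ad\<close> onto
    \<open>C I\<close>, so that only \<open>f k\<close> has to be expanded.\<close>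
  have P_mult: "(\<chi> I k. ip (C I) (Ad X (f k))) = P X ** (\<chi> I k. ip (C I) (f k))"
    if "\<And>k. f k \<in> lie_G2" for X and f :: "14 \<Rightarrow> real^7^7"
  proof -
    have "ip (C I) (Ad X (f k)) = (\<Sum>K\<in>UNIV. ip (C I) (Ad X (C K)) * ip (C K) (f k))" for I k
      using ip_expand [OF that [of k], of "Ad (- X) (C I)"] by (simp add: ip_Ad_left mult.commute)
    then show ?thesis
      by (simp add: P_def vec_eq_iff matrix_matrix_mult_def)
  qed
  have double: "P X = P ((1/2) *\<^sub>R X) ** P ((1/2) *\<^sub>R X)"
  proof -
    have "mexp X = mexp ((1/2) *\<^sub>R X) ** mexp ((1/2) *\<^sub>R X)"
      using mexp_add [of "1/2" "1/2" X] by simp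
    moreover have "mexp (- X) = mexp (- ((1/2) *\<^sub>R X)) ** mexp (- ((1/2) *\<^sub>R X))"
      using mexp_add [of "1/2" "1/2" "- X"] by simp
    ultimately have "Ad X Y = Ad ((1/2) *\<^sub>R X) (Ad ((1/2) *\<^sub>R X) Y)" for Y
      by (simp add: Ad_def matrix_mul_assoc)
    moreover have "(1/2) *\<^sub>R X \<in> lie_G2"
      using X subspace_lie_G2 by (simp add: subspace_def)
    ultimately show ?thesis
      using P_mult [of "\<lambda>k. Ad ((1/2) *\<^sub>R X) (C k)" "(1/2) *\<^sub>R X"] C_lie Ad_in_lie_G2
      by (simp add: P_def)
  qed
  have "P (- X) ** P X = mat 1"
    using P_mult [of "\<lambda>k. Ad X (C k)" "- X"] C_lie Ad_in_lie_G2 [OF X]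
    by (simp add: P_def ip_C mat_def)
  \<comment> \<open>With the previous fact this is orthogonality of \<open>P X\<close>; then
    \<open>double\<close> excludes determinant -1.\<close>
  moreover have "P (- X) = transpose (P X)"
  proof -
    have "ip (C I) (Ad (- X) (C K)) = ip (C K) (Ad X (C I))" for I K
      using ip_Ad_left [of X "C I" "C K"] ip_commute [of "C K" "Ad X (C I)"] by simp
    then show ?thesis by (simp add: P_def transpose_def vec_eq_iff)
  qed
  ultimately have "det (P X) * det (P X) = 1"
    by (metis det_I det_mul det_transpose)
  moreover have "det (P X) \<ge> 0"
    unfolding double by (simp add: det_mul)
  ultimately have "det (P X) = 1"
    using power2_eq_1_iff [of "det (P X)"] by (auto simp: power2_eq_square)
  then show ?thesis
    using P_mult [OF f] by (simp add: wedge_def det_mul)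
qed

lemma wedge_ip_change:
  assumes D: "\<And>K. D K \<in> lie_G2" and f: "\<And>k. f k \<in> lie_G2"
  shows "wedge (\<lambda>I. ip (D I)) f = wedge (\<lambda>I. ip (C I)) D * wedge (\<lambda>I. ip (C I)) f"
proof -
  have "ip (D I) (f k) = (\<Sum>J\<in>UNIV. ip (C J) (D I) * ip (C J) (f k))" for I k
    using ip_expand [OF f [of k], of "D I"] by (simp add: ip_commute [of "D I" "C _"] mult.commute)
  then have "(\<chi> I k. ip (D I) (f k)) = transpose (\<chi> I K. ip (C I) (D K)) ** (\<chi> I k. ip (C I) (f k))"
    by (simp add: vec_eq_iff matrix_matrix_mult_def transpose_def)
  then show ?thesis
    by (simp add: wedge_def det_mul)
qed

lemma wedge_orthonormal:
  assumes "\<And>K. D K \<in> lie_G2" and "\<And>K L. ip (D K) (D L) = (if K = L then 1 else 0)"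
  shows "wedge (\<lambda>I. ip (C I)) D \<in> {1, -1}"
  unfolding wedge_def
proof (rule det_orthogonal_sum)
  fix i j
  show "(\<Sum>k\<in>UNIV. (\<chi> I K. ip (C I) (D K)) $ k $ i * (\<chi> I K. ip (C I) (D K)) $ k $ j) =
      (if i = j then 1 else 0)"
    using ip_expand [OF assms(1) [of j], of "D i"] assms(2) [of i j]
    by (simp add: ip_commute [of "D i" "C _"] mult.commute)
qed

lemma volume_form_left:
  assumes N: "N ** M = mat 1" "M ** N = mat 1" and w: "\<And>k. w k \<in> lie_G2"
  shows "volume_form C M (\<lambda>k. M ** w k) = wedge (\<lambda>I. ip (C I)) w"
proof -
  \<comment> \<open>\<open>matrix_inv\<close> is a Hilbert choice; \<open>N\<close> witnesses that a
    two-sided inverse exists.\<close>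
  have "matrix_inv M ** M = mat 1"
    unfolding matrix_inv_def using someI [of "\<lambda>N. M ** N = mat 1 \<and> N ** M = mat 1"] N by blast
  then show ?thesis
    using w by (simp add: volume_form_def left_form_def wedge_def matrix_mul_assoc representation_C)
qed

end

text \<open>Multiplicativity of the determinant separates the Jacobian from the coordinate volume of
  \<open>u\<close>.\<close>

lemma wedge_linear_comp:
  fixes \<theta> :: "'n::finite \<Rightarrow> 'v::real_vector \<Rightarrow> real" and u :: "'n \<Rightarrow> real^'n"
  assumes \<theta>: "\<And>i. linear (\<theta> i)"
  shows "wedge \<theta> (\<lambda>k. \<Sum>i\<in>UNIV. u k $ i *\<^sub>R W i) = wedge \<theta> W * wedge (\<lambda>i v. v $ i) u"
proof -
  have "(\<chi> j k. \<theta> j (\<Sum>i\<in>UNIV. u k $ i *\<^sub>R W i)) = (\<chi> j i. \<theta> j (W i)) ** (\<chi> i k. u k $ i)"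
    by (simp add: vec_eq_iff matrix_matrix_mult_def linear_sum [OF \<theta>] linear_scale [OF \<theta>] mult.commute)
  then show ?thesis by (simp add: wedge_def det_mul)
qed

section \<open>The Maurer-Cartan form in the coordinates\<close>

lemma Ad_rotation:
  assumes "comm X Y = w *\<^sub>R Z" and "comm X Z = - (w *\<^sub>R Y)"
  shows "Ad (t *\<^sub>R X) Y = cos (w * t) *\<^sub>R Y - sin (w * t) *\<^sub>R Z"
  using mexp_conj_rotation [OF assms [unfolded comm_def]] by (simp add: Ad_def)

lemma Ad_commuting:
  assumes "comm X Y = 0"
  shows "Ad (t *\<^sub>R X) Y = Y"
  using Ad_rotation [of X Y 0 0 t] assms by (simp add: comm.zero_right)

lemma comm_self [simp]: "comm X X = 0"
  by (simp add: comm_def)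

lemma comm_swap: "comm X Y = - comm Y X"
  by (simp add: comm_def)

lemmas Ad_linear_simps =
  linear_add [OF linear_Ad] linear_diff [OF linear_Ad] linear_scale [OF linear_Ad]
  linear_0 [OF linear_Ad]

lemma mult_Ad: "mexp X ** Ad X Y = Y ** mexp X"
proof -
  have "mexp X ** (mexp (- X) ** Y ** mexp X) = (mexp X ** mexp (- X)) ** Y ** mexp X"
    by (simp only: matrix_mul_assoc)
  then show ?thesis by (simp add: Ad_def mexp_minus_right)
qed

lemma Ad_mult: "Ad X Y ** mexp (- X) = mexp (- X) ** Y"
  using mult_Ad [of "- X" "Ad X Y"] by simp

lemma has_derivative_mexp_coord:
  "((\<lambda>a. mexp ((a $ i) *\<^sub>R X)) has_derivative (\<lambda>u. (u $ i) *\<^sub>R (X ** mexp ((a $ i) *\<^sub>R X)))) (at a)"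
  by (rule has_derivative_compose [OF bounded_linear_imp_has_derivative [OF bounded_linear_vec_nth]
        has_vector_derivative_mexp [unfolded has_vector_derivative_def]])

lemma has_derivative_left_mexp:
  "((\<lambda>a. mexp ((a $ i) *\<^sub>R X)) has_derivative (\<lambda>u. mexp ((a $ i) *\<^sub>R X) ** ((u $ i) *\<^sub>R X))) (at a)"
  using has_derivative_mexp_coord [of i X a] by (simp add: matrix_bilinear_simps mexp_scaleR_commute)

lemma has_derivative_right_mexp:
  "((\<lambda>a. mexp ((a $ i) *\<^sub>R X)) has_derivative (\<lambda>u. ((u $ i) *\<^sub>R X) ** mexp ((a $ i) *\<^sub>R X))) (at a)"
  using has_derivative_mexp_coord [of i X a] by (simp add: matrix_bilinear_simps)

lemmas has_derivative_matrix_mult = bounded_bilinear.FDERIV [OF bounded_bilinear_matrix_mult]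

text \<open>If p^{-1} dp = Y, a further exponential on the right conjugates Y and adds its own term;
  the next lemma is the mirror image for dp p^{-1}.\<close>

lemma has_derivative_left_mult_mexp:
  assumes "(p has_derivative (\<lambda>u. p a ** Y u)) (at a)"
  shows "((\<lambda>a. p a ** mexp ((a $ i) *\<^sub>R X)) has_derivative
    (\<lambda>u. (p a ** mexp ((a $ i) *\<^sub>R X)) ** ((u $ i) *\<^sub>R X + Ad ((a $ i) *\<^sub>R X) (Y u)))) (at a)"
proof -
  have "(p a ** mexp ((a $ i) *\<^sub>R X)) ** ((u $ i) *\<^sub>R X + Ad ((a $ i) *\<^sub>R X) (Y u)) =
      p a ** (mexp ((a $ i) *\<^sub>R X) ** ((u $ i) *\<^sub>R X)) + p a ** Y u ** mexp ((a $ i) *\<^sub>R X)" for u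
    by (simp add: matrix_add_ldistrib mult_Ad flip: matrix_mul_assoc)
  then show ?thesis
    using has_derivative_matrix_mult [OF assms has_derivative_left_mexp [of i X a]] by simp
qed

lemma has_derivative_right_mexp_mult:
  assumes "(p has_derivative (\<lambda>u. Y u ** p a)) (at a)"
  shows "((\<lambda>a. mexp ((a $ i) *\<^sub>R X) ** p a) has_derivative
    (\<lambda>u. ((u $ i) *\<^sub>R X + Ad (- ((a $ i) *\<^sub>R X)) (Y u)) ** (mexp ((a $ i) *\<^sub>R X) ** p a))) (at a)"
proof -
  have "((u $ i) *\<^sub>R X + Ad (- ((a $ i) *\<^sub>R X)) (Y u)) ** (mexp ((a $ i) *\<^sub>R X) ** p a) =
      mexp ((a $ i) *\<^sub>R X) ** (Y u ** p a) + ((u $ i) *\<^sub>R X) ** mexp ((a $ i) *\<^sub>R X) ** p a" for u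
    using Ad_mult [of "- ((a $ i) *\<^sub>R X)" "Y u"]
    by (simp add: matrix_mult_add_left matrix_mul_assoc)
  then show ?thesis
    using has_derivative_matrix_mult [OF has_derivative_right_mexp [of i X a] assms] by simp
qed

text \<open>\<open>left_part\<close> is \<open>L T\<close> and \<open>right_part\<close> is \<open>R\<close> in the factorization \<open>g = L T R\<close>.\<close>

definition left_part :: "real^14 \<Rightarrow> real^7^7" where
  "left_part a = mexp ((a $ 1) *\<^sub>R H8) ** mexp ((a $ 2) *\<^sub>R H9) ** mexp ((a $ 3) *\<^sub>R H8) **
     mexp ((a $ 4) *\<^sub>R C3) ** mexp ((a $ 5) *\<^sub>R C2) ** mexp ((a $ 6) *\<^sub>R C3) **
     mexp ((a $ 7) *\<^sub>R H11) ** mexp ((a $ 8) *\<^sub>R C5)"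

definition right_part :: "real^14 \<Rightarrow> real^7^7" where
  "right_part a = mexp ((a $ 9) *\<^sub>R C3) ** (mexp ((a $ 10) *\<^sub>R C2) ** (mexp ((a $ 11) *\<^sub>R C3) **
     (mexp ((a $ 12) *\<^sub>R H8) ** (mexp ((a $ 13) *\<^sub>R H9) ** mexp ((a $ 14) *\<^sub>R H8)))))"

lemma sqrt3_C:
  "(sqrt 3 * x) *\<^sub>R C8 = x *\<^sub>R H8" "(sqrt 3 * x) *\<^sub>R C9 = x *\<^sub>R H9" "(sqrt 3 * x) *\<^sub>R C11 = x *\<^sub>R H11"
  by (simp_all add: C8_def C9_def C11_def H8_def H9_def H11_def)

lemma g_map_eq: "g_map a = left_part a ** right_part a"
  by (simp add: g_map_def sigma_map_def s_map_def sqrt3_C left_part_def right_part_def matrix_mul_assoc)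

lemma C_eq_lie_basis:
  "C3 = lie_basis 9" "C2 = lie_basis 10" "C1 = lie_basis 11" "H8 = lie_basis 12" "H9 = lie_basis 13"
  "H10 = lie_basis 14" "H11 = lie_basis 7" "C5 = lie_basis 8"
  by (simp_all add: lie_basis_def)

lemma lie_basis_in_lie_G2: "lie_basis i \<in> lie_G2"
  by (rule oct_derivation_in_lie_G2 [OF oct_derivation_lie_basis])

lemmas C_in_lie_G2 = lie_basis_in_lie_G2 [of 9, folded C_eq_lie_basis]
  lie_basis_in_lie_G2 [of 10, folded C_eq_lie_basis] lie_basis_in_lie_G2 [of 11, folded C_eq_lie_basis]
  lie_basis_in_lie_G2 [of 12, folded C_eq_lie_basis] lie_basis_in_lie_G2 [of 13, folded C_eq_lie_basis]
  lie_basis_in_lie_G2 [of 14, folded C_eq_lie_basis] lie_basis_in_lie_G2 [of 7, folded C_eq_lie_basis]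
  lie_basis_in_lie_G2 [of 8, folded C_eq_lie_basis]

lemma mexp_in_G2: "X \<in> lie_G2 \<Longrightarrow> mexp (t *\<^sub>R X) \<in> G2"
  by (simp add: lie_G2_def)

lemma g_map_in_G2: "g_map a \<in> G2"
  unfolding g_map_eq left_part_def right_part_def
  by (intro G2_mult mexp_in_G2 C_in_lie_G2)

lemma invertible_mexp: "invertible (mexp X)" for X :: "real^'n^'n"
  using mexp_minus_left mexp_minus_right unfolding invertible_def by blast

lemma invertible_g_map: "invertible (g_map a)"
  unfolding g_map_eq left_part_def right_part_def
  by (intro invertible_mult invertible_mexp)

definition Ad_torus :: "real^14 \<Rightarrow> real^7^7 \<Rightarrow> real^7^7" where
  "Ad_torus a X = Ad ((a $ 8) *\<^sub>R C5) (Ad ((a $ 7) *\<^sub>R H11) X)"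

lemma linear_Ad_torus: "linear (Ad_torus a)"
  unfolding Ad_torus_def using linear_compose [OF linear_Ad linear_Ad] by (simp add: o_def)

lemmas Ad_torus_linear_simps =
  linear_add [OF linear_Ad_torus] linear_diff [OF linear_Ad_torus] linear_scale [OF linear_Ad_torus]

text \<open>Conjugation by R, split into single exponentials so that \<open>wedge_ip_Ad\<close> can
  remove them one by one.\<close>

definition Ad_right :: "real^14 \<Rightarrow> real^7^7 \<Rightarrow> real^7^7" where
  "Ad_right a X = Ad ((a $ 14) *\<^sub>R H8) (Ad ((a $ 13) *\<^sub>R H9) (Ad ((a $ 12) *\<^sub>R H8)
     (Ad ((a $ 11) *\<^sub>R C3) (Ad ((a $ 10) *\<^sub>R C2) (Ad ((a $ 9) *\<^sub>R C3) X)))))"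

text \<open>The \<open>i\<close>-th component of \<open>g\<^sup>-\<^sup>1 dg\<close>, before conjugation by \<open>R\<close>. Vanishing summands are kept so
  that every entry is a combination of a full \<open>su(2)\<close> triple, as the Euler angle determinants expect.\<close>

definition left_frame :: "real^14 \<Rightarrow> 14 \<Rightarrow> real^7^7" where
  "left_frame a i =
    (if i = 1 then Ad_torus a (cos (2 * a $ 2) *\<^sub>R H8 + (sin (2 * a $ 2) * sin (2 * a $ 3)) *\<^sub>R H9 +
        (sin (2 * a $ 2) * cos (2 * a $ 3)) *\<^sub>R H10)
     else if i = 2 then Ad_torus a (0 *\<^sub>R H8 + cos (2 * a $ 3) *\<^sub>R H9 + (- sin (2 * a $ 3)) *\<^sub>R H10)
     else if i = 3 then Ad_torus a (1 *\<^sub>R H8 + 0 *\<^sub>R H9 + 0 *\<^sub>R H10)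
     else if i = 4 then Ad_torus a (cos (2 * a $ 5) *\<^sub>R C3 + (sin (2 * a $ 5) * sin (2 * a $ 6)) *\<^sub>R C2 +
        (sin (2 * a $ 5) * cos (2 * a $ 6)) *\<^sub>R C1)
     else if i = 5 then Ad_torus a (0 *\<^sub>R C3 + cos (2 * a $ 6) *\<^sub>R C2 + (- sin (2 * a $ 6)) *\<^sub>R C1)
     else if i = 6 then Ad_torus a (1 *\<^sub>R C3 + 0 *\<^sub>R C2 + 0 *\<^sub>R C1)
     else if i = 7 then H11 else if i = 8 then C5
     else if i = 9 then 1 *\<^sub>R C3 + 0 *\<^sub>R C2 + 0 *\<^sub>R C1
     else if i = 10 then 0 *\<^sub>R C3 + cos (2 * a $ 9) *\<^sub>R C2 + sin (2 * a $ 9) *\<^sub>R C1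
     else if i = 11 then cos (2 * a $ 10) *\<^sub>R C3 + (sin (2 * a $ 10) * sin (2 * a $ 9)) *\<^sub>R C2 +
        (- sin (2 * a $ 10) * cos (2 * a $ 9)) *\<^sub>R C1
     else if i = 12 then 1 *\<^sub>R H8 + 0 *\<^sub>R H9 + 0 *\<^sub>R H10
     else if i = 13 then 0 *\<^sub>R H8 + cos (2 * a $ 12) *\<^sub>R H9 + sin (2 * a $ 12) *\<^sub>R H10
     else cos (2 * a $ 13) *\<^sub>R H8 + (sin (2 * a $ 13) * sin (2 * a $ 12)) *\<^sub>R H9 +
        (- sin (2 * a $ 13) * cos (2 * a $ 12)) *\<^sub>R H10)"

text \<open>The last three are \<open>Ad_rotation\<close> for the oriented pairs (Y, W), (W, -Y) and
  (X, -W).\<close>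

lemma Ad_triple:
  assumes "comm X Y = 2 *\<^sub>R W" "comm X W = - (2 *\<^sub>R Y)" "comm Y W = 2 *\<^sub>R X"
  shows "Ad (t *\<^sub>R X) X = X" "Ad (t *\<^sub>R X) Y = cos (2 * t) *\<^sub>R Y - sin (2 * t) *\<^sub>R W"
    "Ad (t *\<^sub>R X) W = cos (2 * t) *\<^sub>R W + sin (2 * t) *\<^sub>R Y"
    "Ad (t *\<^sub>R Y) X = cos (2 * t) *\<^sub>R X + sin (2 * t) *\<^sub>R W"
proof -
  show "Ad (t *\<^sub>R X) X = X"
    by (simp add: Ad_commuting)
  show "Ad (t *\<^sub>R X) Y = cos (2 * t) *\<^sub>R Y - sin (2 * t) *\<^sub>R W"
    using assms by (intro Ad_rotation)
  show "Ad (t *\<^sub>R X) W = cos (2 * t) *\<^sub>R W + sin (2 * t) *\<^sub>R Y"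
    using Ad_rotation [of X W 2 "- Y" t] assms by (simp add: comm.minus_right)
  show "Ad (t *\<^sub>R Y) X = cos (2 * t) *\<^sub>R X + sin (2 * t) *\<^sub>R W"
    using Ad_rotation [of Y X 2 "- W" t] assms comm_swap [of Y X] by (simp add: comm.minus_right)
qed

lemma Ad_triple_minus:
  assumes "comm X Y = 2 *\<^sub>R W" "comm X W = - (2 *\<^sub>R Y)" "comm Y W = 2 *\<^sub>R X"
  shows "Ad (- (t *\<^sub>R X)) X = X"
    "Ad (- (t *\<^sub>R X)) Y = cos (2 * t) *\<^sub>R Y + sin (2 * t) *\<^sub>R W"
    "Ad (- (t *\<^sub>R X)) W = cos (2 * t) *\<^sub>R W - sin (2 * t) *\<^sub>R Y"
    "Ad (- (t *\<^sub>R Y)) X = cos (2 * t) *\<^sub>R X - sin (2 * t) *\<^sub>R W"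
  using Ad_triple [OF assms, of "- t"] by simp_all

lemma sum_UNIV_14: "sum f (UNIV::14 set) = f 1 + f 2 + f 3 + f 4 + f 5 + f 6 + f 7 +
    f 8 + f 9 + f 10 + f 11 + f 12 + f 13 + f 14"
  unfolding UNIV_14 by (simp add: ac_simps)

lemma has_derivative_g_map:
  "(g_map has_derivative (\<lambda>u. g_map a ** Ad_right a (\<Sum>i\<in>UNIV. (u $ i) *\<^sub>R left_frame a i))) (at a)"
proof -
  let ?L = "\<lambda>u::real^14. (u $ 8) *\<^sub>R C5 + Ad ((a $ 8) *\<^sub>R C5) ((u $ 7) *\<^sub>R H11 + Ad ((a $ 7) *\<^sub>R H11)
     ((u $ 6) *\<^sub>R C3 + Ad ((a $ 6) *\<^sub>R C3) ((u $ 5) *\<^sub>R C2 + Ad ((a $ 5) *\<^sub>R C2)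
     ((u $ 4) *\<^sub>R C3 + Ad ((a $ 4) *\<^sub>R C3)
     ((u $ 3) *\<^sub>R H8 + Ad ((a $ 3) *\<^sub>R H8) ((u $ 2) *\<^sub>R H9 + Ad ((a $ 2) *\<^sub>R H9) ((u $ 1) *\<^sub>R H8)))))))"
  let ?R = "\<lambda>u::real^14. (u $ 9) *\<^sub>R C3 + Ad (- ((a $ 9) *\<^sub>R C3)) ((u $ 10) *\<^sub>R C2 + Ad (- ((a $ 10) *\<^sub>R C2))
     ((u $ 11) *\<^sub>R C3 + Ad (- ((a $ 11) *\<^sub>R C3)) ((u $ 12) *\<^sub>R H8 + Ad (- ((a $ 12) *\<^sub>R H8))
     ((u $ 13) *\<^sub>R H9 + Ad (- ((a $ 13) *\<^sub>R H9)) ((u $ 14) *\<^sub>R H8)))))"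
  \<comment> \<open>\<open>left_part\<close> is bracketed to the left and \<open>right_part\<close>
    to the right, so each application of a rule peels off one exponential.\<close>
  have L: "(left_part has_derivative (\<lambda>u. left_part a ** ?L u)) (at a)"
    unfolding left_part_def [abs_def]
    by (intro has_derivative_left_mult_mexp has_derivative_left_mexp)
  have R: "(right_part has_derivative (\<lambda>u. ?R u ** right_part a)) (at a)"
    unfolding right_part_def [abs_def]
    by (intro has_derivative_right_mexp_mult has_derivative_right_mexp)
  have Ad_right: "right_part a ** Ad_right a X = X ** right_part a" for X
    by (simp add: right_part_def Ad_right_def mult_Ad flip: matrix_mul_assoc)
      (simp add: matrix_mul_assoc mult_Ad)
  have commuting: "Ad (t *\<^sub>R C3) H8 = H8" "Ad (t *\<^sub>R C3) H9 = H9" "Ad (t *\<^sub>R C3) H10 = H10"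
    "Ad (t *\<^sub>R C2) H8 = H8" "Ad (t *\<^sub>R C2) H9 = H9" "Ad (t *\<^sub>R C2) H10 = H10"
    "Ad (t *\<^sub>R C5) H11 = H11" for t
    using comm_s_sigma comm_H11_C5 comm_swap [of C5 H11] by (auto intro!: Ad_commuting)
  have commuting': "Ad (- (t *\<^sub>R C3)) H8 = H8" "Ad (- (t *\<^sub>R C3)) H9 = H9" "Ad (- (t *\<^sub>R C3)) H10 = H10"
    "Ad (- (t *\<^sub>R C2)) H8 = H8" "Ad (- (t *\<^sub>R C2)) H9 = H9" "Ad (- (t *\<^sub>R C2)) H10 = H10" for t
    using commuting(1-6) [of "- t"] by simp_all
  let ?S = "\<lambda>u::real^14. (u $ 1) *\<^sub>R (cos (2 * a $ 2) *\<^sub>R H8 + (sin (2 * a $ 2) * sin (2 * a $ 3)) *\<^sub>R H9 +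
        (sin (2 * a $ 2) * cos (2 * a $ 3)) *\<^sub>R H10) +
      (u $ 2) *\<^sub>R (0 *\<^sub>R H8 + cos (2 * a $ 3) *\<^sub>R H9 + (- sin (2 * a $ 3)) *\<^sub>R H10) +
      (u $ 3) *\<^sub>R (1 *\<^sub>R H8 + 0 *\<^sub>R H9 + 0 *\<^sub>R H10) +
      (u $ 4) *\<^sub>R (cos (2 * a $ 5) *\<^sub>R C3 + (sin (2 * a $ 5) * sin (2 * a $ 6)) *\<^sub>R C2 +
        (sin (2 * a $ 5) * cos (2 * a $ 6)) *\<^sub>R C1) +
      (u $ 5) *\<^sub>R (0 *\<^sub>R C3 + cos (2 * a $ 6) *\<^sub>R C2 + (- sin (2 * a $ 6)) *\<^sub>R C1) +
      (u $ 6) *\<^sub>R (1 *\<^sub>R C3 + 0 *\<^sub>R C2 + 0 *\<^sub>R C1)"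
  \<comment> \<open>This is the left logarithmic derivative of L. The exponentials of
    \<open>C3\<close> and \<open>C2\<close> commute with the second triple, so the two Euler systems
    stay separate.\<close>
  have S: "(u $ 6) *\<^sub>R C3 + Ad ((a $ 6) *\<^sub>R C3) ((u $ 5) *\<^sub>R C2 + Ad ((a $ 5) *\<^sub>R C2)
     ((u $ 4) *\<^sub>R C3 + Ad ((a $ 4) *\<^sub>R C3) ((u $ 3) *\<^sub>R H8 + Ad ((a $ 3) *\<^sub>R H8)
     ((u $ 2) *\<^sub>R H9 + Ad ((a $ 2) *\<^sub>R H9) ((u $ 1) *\<^sub>R H8))))) = ?S u" for u :: "real^14"
    by (simp add: Ad_linear_simps Ad_triple [OF comm_s] Ad_triple [OF comm_sigma] commuting)
      (simp add: algebra_simps)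
  have R_sum: "?R u = (u $ 9) *\<^sub>R left_frame a 9 + (u $ 10) *\<^sub>R left_frame a 10 + (u $ 11) *\<^sub>R left_frame a 11 +
      (u $ 12) *\<^sub>R left_frame a 12 + (u $ 13) *\<^sub>R left_frame a 13 + (u $ 14) *\<^sub>R left_frame a 14" for u :: "real^14"
    by (simp add: left_frame_def Ad_linear_simps Ad_triple_minus [OF comm_s]
        Ad_triple_minus [OF comm_sigma] commuting') (simp add: algebra_simps)
  have L_sum: "?L u = (u $ 1) *\<^sub>R left_frame a 1 + (u $ 2) *\<^sub>R left_frame a 2 + (u $ 3) *\<^sub>R left_frame a 3 +
      (u $ 4) *\<^sub>R left_frame a 4 + (u $ 5) *\<^sub>R left_frame a 5 + (u $ 6) *\<^sub>R left_frame a 6 +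
      (u $ 7) *\<^sub>R left_frame a 7 + (u $ 8) *\<^sub>R left_frame a 8" for u :: "real^14"
  proof -
    have "?L u = (u $ 8) *\<^sub>R C5 + (u $ 7) *\<^sub>R H11 + Ad_torus a (?S u)"
      unfolding S by (simp add: Ad_linear_simps commuting Ad_torus_def)
    also have "Ad_torus a (?S u) = (u $ 1) *\<^sub>R left_frame a 1 + (u $ 2) *\<^sub>R left_frame a 2 + (u $ 3) *\<^sub>R left_frame a 3 +
      (u $ 4) *\<^sub>R left_frame a 4 + (u $ 5) *\<^sub>R left_frame a 5 + (u $ 6) *\<^sub>R left_frame a 6"
      by (simp only: Ad_torus_linear_simps(1,3) left_frame_def) simp
    finally show ?thesis by (simp add: left_frame_def)
  qed
  have LR: "?L u + ?R u = (\<Sum>i\<in>UNIV. (u $ i) *\<^sub>R left_frame a i)" for u :: "real^14"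
    unfolding L_sum R_sum sum_UNIV_14 by (simp only: add.assoc)
  have "left_part a ** (?R u ** right_part a) + (left_part a ** ?L u) ** right_part a =
      g_map a ** Ad_right a (?L u + ?R u)" for u :: "real^14"
  proof -
    have "g_map a ** Ad_right a X = left_part a ** (X ** right_part a)" for X
      by (simp add: g_map_eq Ad_right flip: matrix_mul_assoc)
    then show ?thesis
      by (simp add: matrix_mult_add_left matrix_add_ldistrib flip: matrix_mul_assoc)
  qed
  moreover have "(g_map has_derivative (\<lambda>u. left_part a ** (?R u ** right_part a) + (left_part a ** ?L u) ** right_part a)) (at a)"
    using has_derivative_matrix_mult [OF L R] unfolding g_map_eq [abs_def] .
  ultimately show ?thesis
    unfolding LR by simp
qed

section \<open>The determinant of the frame\<close>

definition unit_basis :: "14 \<Rightarrow> real^7^7" where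
  "unit_basis i = (1 / sqrt (lie_norm i)) *\<^sub>R lie_basis i"

lemma lie_norm_pos: "lie_norm i > 0"
  by (simp add: lie_norm_def)

lemma ip_unit_basis: "ip (unit_basis i) (unit_basis j) = (if i = j then 1 else 0)"
  using lie_norm_pos [of i]
  by (auto simp: unit_basis_def ip.scaleR_left ip.scaleR_right ip_lie_basis)

lemma prod_UNIV_14: "prod f (UNIV::14 set) = f 1 * f 2 * f 3 * f 4 * f 5 * f 6 * f 7 *
    f 8 * f 9 * f 10 * f 11 * f 12 * f 13 * f 14"
  unfolding UNIV_14 by (simp add: ac_simps)

lemma wedge_unit_basis:
  "wedge (\<lambda>I. ip (unit_basis I)) f = wedge (\<lambda>I. ip (lie_basis I)) f / (108 * sqrt 3)"
proof -
  have "wedge (\<lambda>I. ip (unit_basis I)) f =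
      det (\<chi> I. (1 / sqrt (lie_norm I)) *s (\<chi> k. ip (lie_basis I) (f k)))"
    by (simp add: wedge_def unit_basis_def ip.scaleR_left vector_scalar_mult_def)
  also have "\<dots> = (\<Prod>I\<in>UNIV. 1 / sqrt (lie_norm I)) * wedge (\<lambda>I. ip (lie_basis I)) f"
    by (simp only: det_rows_mul wedge_def)
  also have "(\<Prod>I\<in>UNIV. 1 / sqrt (lie_norm I)) = 1 / sqrt (\<Prod>I\<in>UNIV. lie_norm I)"
    by (simp only: prod_UNIV_14 real_sqrt_mult times_divide_times_eq mult_1)
  also have "(\<Prod>I\<in>UNIV. lie_norm I) = 108\<^sup>2 * 3"
    by (simp add: prod_UNIV_14 lie_norm_def)
  also have "sqrt (108\<^sup>2 * 3) = 108 * sqrt 3"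
    by (simp only: real_sqrt_mult real_sqrt_abs abs_numeral)
  finally show ?thesis by simp
qed

text \<open>Both torus factors rotate the same plane, so their angles add up to the value of the
  root.\<close>

lemma Ad_torus_root_vec:
  assumes "i \<in> {1, 2, 3, 4, 5, 6}"
  shows "Ad_torus a (root_vec i) =
    cos (root_H11 i * a $ 7 + root_C5 i * a $ 8) *\<^sub>R root_vec i -
    sin (root_H11 i * a $ 7 + root_C5 i * a $ 8) *\<^sub>R lie_basis i"
proof -
  note c = comm_root_vec [OF assms]
  have "Ad (t *\<^sub>R C5) (lie_basis i) =
      cos (root_C5 i * t) *\<^sub>R lie_basis i + sin (root_C5 i * t) *\<^sub>R root_vec i" for t
    using Ad_rotation [of C5 "lie_basis i" "root_C5 i" "- root_vec i" t] c
    by (simp add: comm.minus_right)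
  then show ?thesis
    by (simp add: Ad_torus_def Ad_rotation [OF c(1,2)] Ad_rotation [OF c(3,4)] Ad_linear_simps
        cos_add sin_add algebra_simps)
qed

lemma linear_ip: "linear (ip X)"
  using ip.bounded_linear_right bounded_linear.linear by blast

text \<open>What \<open>left_frame\<close> becomes once the Euler angle combinations and the change from the \<open>su(2)\<close>
  triples to root vectors are removed by column operations.\<close>

definition torus_frame :: "real^14 \<Rightarrow> 14 \<Rightarrow> real^7^7" where
  "torus_frame a i = (if i \<in> {1, 2, 3, 4, 5, 6} then Ad_torus a (root_vec i) else lie_basis i)"

text \<open>The first eight basis elements are orthogonal to so(4), so their rows see only the sine
  parts. The cosine parts lie in so(4) and fill the off-diagonal block of a block triangular
  matrix.\<close>

lemma wedge_torus_frame:
  "wedge (\<lambda>I. ip (lie_basis I)) (torus_frame a) =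
    34992 * sin (2 * a $ 7) * sin (a $ 8 + a $ 7) * sin (a $ 8 - a $ 7) * sin (2 * a $ 8) *
      sin (a $ 8 + 3 * a $ 7) * sin (a $ 8 - 3 * a $ 7)"
proof -
  let ?S = "{1, 2, 3, 4, 5, 6, 7, 8} :: 14 set"
  let ?M = "\<chi> I k. ip (lie_basis I) (torus_frame a k) :: real^14^14"
  have frame: "torus_frame a j =
      (if j \<in> {1, 2, 3, 4, 5, 6} then
        cos (root_H11 j * a $ 7 + root_C5 j * a $ 8) *\<^sub>R root_vec j -
        sin (root_H11 j * a $ 7 + root_C5 j * a $ 8) *\<^sub>R lie_basis j else lie_basis j)" for j
    using Ad_torus_root_vec by (simp add: torus_frame_def)
  have row: "ip (lie_basis I) (torus_frame a j) =
      (if I = j then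
         (if j \<in> {1, 2, 3, 4, 5, 6} then - sin (root_H11 j * a $ 7 + root_C5 j * a $ 8) else 1) * lie_norm j
       else 0)" if "I \<in> ?S" for I j
  proof (cases "j \<in> {1, 2, 3, 4, 5, 6}")
    case True
    then show ?thesis
      unfolding frame using ip_lie_basis_root_vec [OF that True]
      by (simp only: if_True ip.diff_right ip.scaleR_right ip_lie_basis) simp
  next
    case False
    then show ?thesis
      unfolding frame by (simp only: if_False ip_lie_basis) simp
  qed
  have "det ?M = (\<Prod>I\<in>UNIV. ?M $ I $ I)"
  proof (rule det_block_diagonal [of ?S])
    fix i j
    show "?M $ i $ j = 0" if "i \<in> ?S" "j \<noteq> i"
      using row [OF that(1), of j] that(2) by simp
    show "?M $ i $ j = 0" if "i \<notin> ?S" "j \<notin> ?S" "j \<noteq> i"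
      using that by (simp add: torus_frame_def ip_lie_basis)
  qed
  also have "\<dots> = (\<Prod>I\<in>UNIV. (if I \<in> {1, 2, 3, 4, 5, 6} then
      - sin (root_H11 I * a $ 7 + root_C5 I * a $ 8) else 1) * lie_norm I)"
  proof (rule prod.cong)
    fix I :: 14
    show "?M $ I $ I = (if I \<in> {1, 2, 3, 4, 5, 6} then
      - sin (root_H11 I * a $ 7 + root_C5 I * a $ 8) else 1) * lie_norm I"
    proof (cases "I \<in> ?S")
      case True
      then show ?thesis using row [OF True, of I] by simp
    next
      case False
      then show ?thesis by (simp add: torus_frame_def ip_lie_basis)
    qed
  qed simp
  \<comment> \<open>34992 = 108^2 * 3 is the product of all \<open>lie_norm\<close> values; the six
    minus signs cancel.\<close>
  also have "\<dots> = 34992 * sin (2 * a $ 7) * sin (a $ 8 + a $ 7) * sin (a $ 8 - a $ 7) * sin (2 * a $ 8) *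
      sin (a $ 8 + 3 * a $ 7) * sin (a $ 8 - 3 * a $ 7)"
    by (simp add: prod_UNIV_14 lie_norm_def root_H11_def root_C5_def add.commute)
  finally show ?thesis by (simp add: wedge_def)
qed

text \<open>The SU(2) volume in Euler angles: the 3 by 3 coefficient determinant collapses to the
  sine of the middle angle, with a sign, by sin^2 + cos^2 = 1.\<close>

lemma wedge_euler_left:
  fixes v :: "'n::finite \<Rightarrow> 'v::real_vector"
  assumes "\<And>i. linear (\<theta> i)" "p \<noteq> q" "p \<noteq> r" "q \<noteq> r"
    and "v p = cos y *\<^sub>R X + (sin y * sin z) *\<^sub>R Y + (sin y * cos z) *\<^sub>R W"
      "v q = 0 *\<^sub>R X + cos z *\<^sub>R Y + (- sin z) *\<^sub>R W"
      "v r = 1 *\<^sub>R X + 0 *\<^sub>R Y + 0 *\<^sub>R W"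
  shows "wedge \<theta> v = - sin y * wedge \<theta> (v(p := X, q := Y, r := W))"
proof (rule wedge_upd3 [OF assms, THEN trans], rule arg_cong2 [where f = "(*)"])
  show "cos y * (cos z * 0 - - sin z * 0) - sin y * sin z * (0 * 0 - - sin z * 1) +
      sin y * cos z * (0 * 0 - cos z * 1) = - sin y"
    using sin_cos_squared_add [of z] by algebra
qed simp

lemma wedge_euler_right:
  fixes v :: "'n::finite \<Rightarrow> 'v::real_vector"
  assumes "\<And>i. linear (\<theta> i)" "p \<noteq> q" "p \<noteq> r" "q \<noteq> r"
    and "v p = 1 *\<^sub>R X + 0 *\<^sub>R Y + 0 *\<^sub>R W"
      "v q = 0 *\<^sub>R X + cos z *\<^sub>R Y + sin z *\<^sub>R W"
      "v r = cos y *\<^sub>R X + (sin y * sin z) *\<^sub>R Y + (- sin y * cos z) *\<^sub>R W"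
  shows "wedge \<theta> v = - sin y * wedge \<theta> (v(p := X, q := Y, r := W))"
proof (rule wedge_upd3 [OF assms, THEN trans], rule arg_cong2 [where f = "(*)"])
  show "1 * (cos z * (- sin y * cos z) - sin z * (sin y * sin z)) -
      0 * (0 * (- sin y * cos z) - sin z * cos y) + 0 * (0 * (sin y * sin z) - cos z * cos y) = - sin y"
    using sin_cos_squared_add [of z] by algebra
qed simp

text \<open>The four signs from the Euler angles cancel. The five changes to root vectors have
  factors -1, 1, -1, -1/2, -1/2, whose product is 1/4.\<close>

lemma wedge_left_frame:
  assumes \<theta>: "\<And>I. linear (\<theta> I)"
  shows "wedge \<theta> (left_frame a) =
    sin (2 * a $ 2) * sin (2 * a $ 5) * sin (2 * a $ 10) * sin (2 * a $ 13) / 4 *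
    wedge \<theta> (torus_frame a)"
proof -
  define w where "w = left_frame a"
  define w1 where "w1 = w(1 := Ad_torus a H8, 2 := Ad_torus a H9, 3 := Ad_torus a H10)"
  define w2 where "w2 = w1(4 := Ad_torus a C3, 5 := Ad_torus a C2, 6 := Ad_torus a C1)"
  define w3 where "w3 = w2(9 := C3, 10 := C2, 11 := C1)"
  define w4 where "w4 = w3(12 := H8, 13 := H9, 14 := H10)"
  define w5 where "w5 = w4(4 := Ad_torus a (root_vec 4), 1 := Ad_torus a (root_vec 1))"
  \<comment> \<open>\<open>K\<close>, \<open>K'\<close> are the half-sum and half-difference of the
    long root vectors 5 and 6, and \<open>N\<close>, \<open>N'\<close> those of the short ones 3 and
    2; they reduce a mixing of four vectors to 2 by 2 steps. Slots are replaced so that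
    \<open>root_vec i\<close> ends up in slot \<open>i\<close>.\<close>
  define K where "K = Ad_torus a ((1 / 2) *\<^sub>R root_vec 5 + (1 / 2) *\<^sub>R root_vec 6)"
  define K' where "K' = Ad_torus a ((1 / 2) *\<^sub>R root_vec 5 + (- 1 / 2) *\<^sub>R root_vec 6)"
  define N where "N = Ad_torus a ((1 / 2) *\<^sub>R root_vec 3 + (1 / 2) *\<^sub>R root_vec 2)"
  define N' where "N' = Ad_torus a ((1 / 2) *\<^sub>R root_vec 3 + (- 1 / 2) *\<^sub>R root_vec 2)"
  define w6 where "w6 = w5(5 := K, 3 := N)"
  define w7 where "w7 = w6(6 := K', 2 := N')"
  define w8 where "w8 = w7(5 := Ad_torus a (root_vec 5), 6 := Ad_torus a (root_vec 6))"
  define w9 where "w9 = w8(3 := Ad_torus a (root_vec 3), 2 := Ad_torus a (root_vec 2))"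
  have F: "Ad_torus a C3 = (1 / 2) *\<^sub>R Ad_torus a (root_vec 4) + (1 / 2) *\<^sub>R Ad_torus a (root_vec 1)"
    "Ad_torus a H8 = (3 / 2) *\<^sub>R Ad_torus a (root_vec 4) + (- 1 / 2) *\<^sub>R Ad_torus a (root_vec 1)"
    "Ad_torus a C2 = (1 / 2) *\<^sub>R K + (1 / 2) *\<^sub>R N" "Ad_torus a H10 = (- 3 / 2) *\<^sub>R K + (1 / 2) *\<^sub>R N"
    "Ad_torus a C1 = (1 / 2) *\<^sub>R K' + (1 / 2) *\<^sub>R N'" "Ad_torus a H9 = (3 / 2) *\<^sub>R K' + (- 1 / 2) *\<^sub>R N'"
    unfolding K_def K'_def N_def N'_def
    by (subst mix_root_vec, simp only: Ad_torus_linear_simps(1,3))+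
  note w_defs = w_def w1_def w2_def w3_def w4_def w5_def w6_def w7_def w8_def w9_def left_frame_def
  have 1: "wedge \<theta> w = - sin (2 * a $ 2) * wedge \<theta> w1"
    unfolding w1_def
    by (rule wedge_euler_left [OF \<theta>, where z = "2 * a $ 3"])
      (simp_all add: w_defs Ad_torus_linear_simps linear_neg [OF linear_Ad_torus])
  have 2: "wedge \<theta> w1 = - sin (2 * a $ 5) * wedge \<theta> w2"
    unfolding w2_def
    by (rule wedge_euler_left [OF \<theta>, where z = "2 * a $ 6"])
      (simp_all add: w_defs Ad_torus_linear_simps linear_neg [OF linear_Ad_torus])
  have 3: "wedge \<theta> w2 = - sin (2 * a $ 10) * wedge \<theta> w3"
    unfolding w3_def
    by (rule wedge_euler_right [OF \<theta>, where z = "2 * a $ 9"]) (simp_all add: w_defs)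
  have 4: "wedge \<theta> w3 = - sin (2 * a $ 13) * wedge \<theta> w4"
    unfolding w4_def
    by (rule wedge_euler_right [OF \<theta>, where z = "2 * a $ 12"]) (simp_all add: w_defs)
  have "w4 4 = Ad_torus a C3" "w4 1 = Ad_torus a H8"
    by (simp_all add: w_defs)
  from wedge_upd2 [OF \<theta> _ this [unfolded F]] have 5: "wedge \<theta> w4 = - wedge \<theta> w5"
    by (simp add: w5_def)
  have "w5 5 = Ad_torus a C2" "w5 3 = Ad_torus a H10"
    by (simp_all add: w_defs)
  from wedge_upd2 [OF \<theta> _ this [unfolded F]] have 6: "wedge \<theta> w5 = wedge \<theta> w6"
    by (simp add: w6_def)
  have "w6 6 = Ad_torus a C1" "w6 2 = Ad_torus a H9"
    by (simp_all add: w_defs)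
  from wedge_upd2 [OF \<theta> _ this [unfolded F]] have 7: "wedge \<theta> w6 = - wedge \<theta> w7"
    by (simp add: w7_def)
  have "w7 5 = (1 / 2) *\<^sub>R Ad_torus a (root_vec 5) + (1 / 2) *\<^sub>R Ad_torus a (root_vec 6)"
    "w7 6 = (1 / 2) *\<^sub>R Ad_torus a (root_vec 5) + (- 1 / 2) *\<^sub>R Ad_torus a (root_vec 6)"
    by (simp_all add: w7_def w6_def K_def K'_def Ad_torus_linear_simps del: scaleR_minus_left)
  from wedge_upd2 [OF \<theta> _ this] have 8: "wedge \<theta> w7 = - 1 / 2 * wedge \<theta> w8"
    by (simp add: w8_def)
  have "w8 3 = (1 / 2) *\<^sub>R Ad_torus a (root_vec 3) + (1 / 2) *\<^sub>R Ad_torus a (root_vec 2)"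
    "w8 2 = (1 / 2) *\<^sub>R Ad_torus a (root_vec 3) + (- 1 / 2) *\<^sub>R Ad_torus a (root_vec 2)"
    by (simp_all add: w8_def w7_def w6_def N_def N'_def Ad_torus_linear_simps del: scaleR_minus_left)
  from wedge_upd2 [OF \<theta> _ this] have 9: "wedge \<theta> w8 = - 1 / 2 * wedge \<theta> w9"
    by (simp add: w9_def)
  have "w9 = torus_frame a"
  proof -
    have "\<forall>i. w9 i = torus_frame a i"
      unfolding forall_14 w1_def w2_def w3_def w4_def w5_def w6_def w7_def w8_def w9_def
      by (simp add: torus_frame_def lie_basis_def w_def left_frame_def)
    then show ?thesis by blast
  qed
  then show ?thesis
    unfolding w_def [symmetric] 1 2 3 4 5 6 7 8 9 by simp
qed

lemma left_frame_in_lie_G2: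
  assumes "subspace lie_G2"
  shows "left_frame a i \<in> lie_G2"
proof -
  have F: "Ad_torus a X \<in> lie_G2" if "X \<in> lie_G2" for X
    unfolding Ad_torus_def using that assms C_in_lie_G2
    by (intro Ad_in_lie_G2) (auto intro: subspace_scale)
  have "\<forall>i. left_frame a i \<in> lie_G2"
    unfolding forall_14 left_frame_def
    by (simp, intro conjI F subspace_add [OF assms] subspace_diff [OF assms]
        subspace_scale [OF assms] C_in_lie_G2)
  then show ?thesis by blast
qed

lemma wedge_unit_basis_left_frame:
  "wedge (\<lambda>I. ip (unit_basis I)) (left_frame a) =
    27 * sqrt 3 * f_fun (2 * a $ 7) (2 * a $ 8) *
      sin (2 * a $ 2) * sin (2 * a $ 5) * sin (2 * a $ 10) * sin (2 * a $ 13)"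
proof -
  have *: "(2 * y - 2 * x) / 2 = y - x" "(2 * y + 2 * x) / 2 = y + x"
    "(2 * y - 3 * (2 * x)) / 2 = y - 3 * x" "(2 * y + 3 * (2 * x)) / 2 = y + 3 * x" for x y :: real
    by (simp_all add: field_simps)
  have "sqrt 3 * sqrt 3 = 3" by simp
  then show ?thesis
    unfolding wedge_unit_basis wedge_left_frame [OF linear_ip] wedge_torus_frame f_fun_def *
    by (simp add: field_simps)
qed

lemma unit_basis_in_lie_G2:
  assumes "subspace lie_G2"
  shows "unit_basis i \<in> lie_G2"
  unfolding unit_basis_def by (intro subspace_scale [OF assms] lie_basis_in_lie_G2)

section \<open>The orientation sign and the pulled-back volume form\<close>

context orthonormal_lie
begin

text \<open>Comparison with one fixed reference basis makes the sign depend on \<open>C\<close>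
  alone.\<close>

definition orientation_sign :: real where
  "orientation_sign = wedge (\<lambda>I. ip (C I)) unit_basis"

lemma orientation_sign: "orientation_sign \<in> {1, -1}"
  unfolding orientation_sign_def
  by (intro wedge_orthonormal unit_basis_in_lie_G2 subspace_lie_G2 ip_unit_basis)

lemma wedge_ip_Ad_right:
  assumes "\<And>k. f k \<in> lie_G2"
  shows "wedge (\<lambda>I. ip (C I)) (\<lambda>k. Ad_right a (f k)) = wedge (\<lambda>I. ip (C I)) f"
proof -
  have scale: "t *\<^sub>R X \<in> lie_G2" if "X \<in> lie_G2" for t X
    using that by (rule subspace_scale [OF subspace_lie_G2])
  show ?thesis
    unfolding Ad_right_def
    by (simp add: wedge_ip_Ad Ad_in_lie_G2 scale assms C_in_lie_G2)
qed

lemma Ad_right_in_lie_G2: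
  assumes "X \<in> lie_G2"
  shows "Ad_right a X \<in> lie_G2"
  unfolding Ad_right_def
  by (intro Ad_in_lie_G2 subspace_scale [OF subspace_lie_G2] C_in_lie_G2 assms)

text \<open>Changing from \<open>C\<close> to \<open>unit_basis\<close> multiplies by the sign, and
  a sign is its own inverse.\<close>

lemma wedge_ip_left_frame:
  "wedge (\<lambda>I. ip (C I)) (left_frame a) =
    orientation_sign * (27 * sqrt 3 * f_fun (2 * a $ 7) (2 * a $ 8) *
      sin (2 * a $ 2) * sin (2 * a $ 5) * sin (2 * a $ 10) * sin (2 * a $ 13))"
proof -
  have "wedge (\<lambda>I. ip (unit_basis I)) (left_frame a) =
      orientation_sign * wedge (\<lambda>I. ip (C I)) (left_frame a)"
    unfolding orientation_sign_def
    by (intro wedge_ip_change unit_basis_in_lie_G2 left_frame_in_lie_G2 subspace_lie_G2)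
  then show ?thesis
    using orientation_sign by (auto simp: wedge_unit_basis_left_frame)
qed

lemma pullback_volume_form:
  "pullback g_map (volume_form C) a u =
    orientation_sign * (27 * sqrt 3 * f_fun (2 * a $ 7) (2 * a $ 8) *
      sin (2 * a $ 2) * sin (2 * a $ 5) * sin (2 * a $ 10) * sin (2 * a $ 13)) *
    wedge (\<lambda>i v. v $ i) u"
proof -
  define w where "w k = (\<Sum>i\<in>UNIV. (u k $ i) *\<^sub>R left_frame a i)" for k
  have w: "w k \<in> lie_G2" for k
    unfolding w_def
    by (intro subspace_sum [OF subspace_lie_G2] subspace_scale [OF subspace_lie_G2]
        left_frame_in_lie_G2 subspace_lie_G2)
  obtain N where N: "N ** g_map a = mat 1" "g_map a ** N = mat 1"
    using invertible_g_map unfolding invertible_def by blast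
  have "frechet_derivative g_map (at a) =
      (\<lambda>u. g_map a ** Ad_right a (\<Sum>i\<in>UNIV. (u $ i) *\<^sub>R left_frame a i))"
    using has_derivative_g_map by (rule frechet_derivative_at [symmetric])
  then have "pullback g_map (volume_form C) a u =
      volume_form C (g_map a) (\<lambda>k. g_map a ** Ad_right a (w k))"
    by (simp add: pullback_def w_def)
  also have "\<dots> = wedge (\<lambda>I. ip (C I)) (\<lambda>k. Ad_right a (w k))"
    by (intro volume_form_left [OF N] Ad_right_in_lie_G2 w)
  also have "\<dots> = wedge (\<lambda>I. ip (C I)) w"
    by (intro wedge_ip_Ad_right w)
  also have "\<dots> = wedge (\<lambda>I. ip (C I)) (left_frame a) * wedge (\<lambda>i v. v $ i) u"
    unfolding w_def [abs_def] by (rule wedge_linear_comp [OF linear_ip])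
  finally show ?thesis
    by (simp only: wedge_ip_left_frame)
qed

text \<open>The two signs differ by the determinant of the change of basis, which is positive by
  hypothesis.\<close>

lemma orientation_sign_eq:
  assumes "orthonormal_lie C'" and "same_orientation C C'"
  shows "orientation_sign = orthonormal_lie.orientation_sign C'"
proof -
  interpret C': orthonormal_lie C' by fact
  have "C'.orientation_sign = wedge (\<lambda>I. ip (C I)) C' * orientation_sign"
    unfolding orientation_sign_def C'.orientation_sign_def
    by (intro wedge_ip_change C'.C_lie unit_basis_in_lie_G2 subspace_lie_G2)
  moreover have "wedge (\<lambda>I. ip (C I)) C' > 0"
    using assms(2) by (simp add: same_orientation_def wedge_def representation_C C'.C_lie)
  ultimately show ?thesis
    using orientation_sign C'.orientation_sign by auto
qed

end

theorem mainTheorem2: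
  shows
    "(\<forall>a. g_map a \<in> G2 \<and> g_map differentiable at a) \<and>
     (\<exists>\<epsilon> :: (14 \<Rightarrow> real ^ 7 ^ 7) \<Rightarrow> real.
        (\<forall>C. orthonormal_basis_lie C \<longrightarrow>
           \<epsilon> C \<in> {1, -1} \<and>
           (\<forall>a u. pullback g_map (volume_form C) a u =
              \<epsilon> C *
              (27 * sqrt 3 * f_fun (2 * a $ 7) (2 * a $ 8) *
               sin (2 * a $ 2) * sin (2 * a $ 5) * sin (2 * a $ 10) * sin (2 * a $ 13)) *
              wedge (\<lambda>i v. v $ i) u)) \<and>
        (\<forall>C C'. orthonormal_basis_lie C \<longrightarrow> orthonormal_basis_lie C' \<longrightarrow>
           same_orientation C C' \<longrightarrow> \<epsilon> C = \<epsilon> C')) \<and>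
     (\<forall>C \<mu>. orthonormal_basis_lie C \<longrightarrow> haar_measure \<mu> \<longrightarrow>
        normalized_by (volume_form C) \<mu> \<longrightarrow>
        (\<forall>U. coordinates_on U g_map \<longrightarrow>
           (\<forall>B\<in>sets borel. B \<subseteq> U \<longrightarrow>
              emeasure \<mu> (g_map ` B) =
              (\<integral>\<^sup>+a\<in>B. ennreal \<bar>27 * sqrt 3 * f_fun (2 * a $ 7) (2 * a $ 8) *
                 sin (2 * a $ 2) * sin (2 * a $ 5) * sin (2 * a $ 10) * sin (2 * a $ 13)\<bar>
               \<partial>lborel))))"
proof (intro conjI allI)
  fix a
  show "g_map a \<in> G2" by (rule g_map_in_G2)
  show "g_map differentiable at a"
    using has_derivative_g_map unfolding differentiable_def by blast
next
  show "\<exists>\<epsilon> :: (14 \<Rightarrow> real ^ 7 ^ 7) \<Rightarrow> real.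
        (\<forall>C. orthonormal_basis_lie C \<longrightarrow>
           \<epsilon> C \<in> {1, -1} \<and>
           (\<forall>a u. pullback g_map (volume_form C) a u =
              \<epsilon> C *
              (27 * sqrt 3 * f_fun (2 * a $ 7) (2 * a $ 8) *
               sin (2 * a $ 2) * sin (2 * a $ 5) * sin (2 * a $ 10) * sin (2 * a $ 13)) *
              wedge (\<lambda>i v. v $ i) u)) \<and>
        (\<forall>C C'. orthonormal_basis_lie C \<longrightarrow> orthonormal_basis_lie C' \<longrightarrow>
           same_orientation C C' \<longrightarrow> \<epsilon> C = \<epsilon> C')"
    \<comment> \<open>Outside the locale the sign is a function of \<open>C\<close>, which is the
      required witness.\<close>
    using orthonormal_lie.orientation_sign orthonormal_lie.pullback_volume_form
      orthonormal_lie.orientation_sign_eq orthonormal_lie.intro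
    by (intro exI [of _ orthonormal_lie.orientation_sign]) blast
next
  fix C \<mu>
  show "orthonormal_basis_lie C \<longrightarrow> haar_measure \<mu> \<longrightarrow>
        normalized_by (volume_form C) \<mu> \<longrightarrow>
        (\<forall>U. coordinates_on U g_map \<longrightarrow>
           (\<forall>B\<in>sets borel. B \<subseteq> U \<longrightarrow>
              emeasure \<mu> (g_map ` B) =
              (\<integral>\<^sup>+a\<in>B. ennreal \<bar>27 * sqrt 3 * f_fun (2 * a $ 7) (2 * a $ 8) *
                 sin (2 * a $ 2) * sin (2 * a $ 5) * sin (2 * a $ 10) * sin (2 * a $ 13)\<bar>
               \<partial>lborel)))"
  proof (intro impI allI ballI)
    fix U B
    assume C: "orthonormal_basis_lie C" and \<mu>: "normalized_by (volume_form C) \<mu>"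
      and U: "coordinates_on U g_map" and B: "B \<in> sets borel" "B \<subseteq> U"
    interpret orthonormal_lie C by standard (rule C)
    \<comment> \<open>On the coordinate vectors the coordinate volume is 1, and the absolute value
      removes the orientation sign; normalization is then applied to the chart
      \<open>g_map\<close>.\<close>
    have "wedge (\<lambda>i v. v $ i) (\<lambda>k. axis k 1 :: real^14) = det (mat 1 :: real^14^14)"
      unfolding wedge_def by (rule arg_cong [of _ _ det]) (auto simp: vec_eq_iff mat_def axis_def)
    then have "\<bar>pullback g_map (volume_form C) a (\<lambda>k. axis k 1)\<bar> =
        \<bar>27 * sqrt 3 * f_fun (2 * a $ 7) (2 * a $ 8) *
          sin (2 * a $ 2) * sin (2 * a $ 5) * sin (2 * a $ 10) * sin (2 * a $ 13)\<bar>" for a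
      using orientation_sign by (auto simp: pullback_volume_form)
    moreover have "emeasure \<mu> (g_map ` B) =
        (\<integral>\<^sup>+a\<in>B. ennreal \<bar>pullback g_map (volume_form C) a (\<lambda>k. axis k 1)\<bar> \<partial>lborel)"
      using \<mu> U B unfolding normalized_by_def by blast
    ultimately show "emeasure \<mu> (g_map ` B) =
        (\<integral>\<^sup>+a\<in>B. ennreal \<bar>27 * sqrt 3 * f_fun (2 * a $ 7) (2 * a $ 8) *
           sin (2 * a $ 2) * sin (2 * a $ 5) * sin (2 * a $ 10) * sin (2 * a $ 13)\<bar>
         \<partial>lborel)"
      by simp
  qed
qed

end
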